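(* Let $\mathcal{T}=\{R_{\alpha_1}P_{i_1}+t_1,\ R_{\alpha_2}P_{i_2}+t_2,\ \ldots\}$ be a primitive substitution tiling of $\mathbb{R}^2$ of statistical circular symmetry, with prototiles $P_1,\ldots,P_m$. Choose points $x_i\in P_i$ for $1\le i\le m$, and define $\Lambda=\{R_{\alpha_1}x_{i_1}+t_1,\ R_{\alpha_2}x_{i_2}+t_2,\ \ldots\}$. Then the autocorrelation $\gamma_\Lambda$ of $\Lambda$ is circular symmetric, i.e. $R.\gamma_\Lambda=\gamma_\Lambda$ for every rotation $R$ of $\mathbb{R}^2$ about the origin.
   Context: Prototiles and tiles. The prototiles $P_1,\ldots,P_m$ are compact subsets of $\mathbb{R}^2$, each equal to the closure of its interior. A tile is a set of the form $R_\alpha P_i+t$, where $R_\alpha$ is the rotation about the origin through the angle $\alpha\in[0,2\pi[$ and $t\in\mathbb{R}^2$; its orientation is $\phi(R_\alpha P_i+t)=\alpha$. Two prototiles may be congruent as sets; in that case they carry distinguishing decorations, every tile carries the decoration of its prototile, and "congruent" always means with respect to decorations. A tiling is a collection of tiles covering $\mathbb{R}^2$ such that every $x\in\mathbb{R}^2$ lies in the interior of at most one tile. Substitutions. A substitution $\sigma$ with inflation factor $\lambda>1$ maps each prototile $P_i$ to a finite non-overlapping collection $\sigma(P_i)$ of tiles, each congruent to some prototile, and is assumed selfsimilar: $\lambda P_i=\bigcup_{T\in\sigma(P_i)}T$ for $1\le i\le m$. It extends to tiles by $\sigma(RP_i+t)=R\,\sigma(P_i)+\lambda t$ ($R$ a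 rotation, $t\in\mathbb{R}^2$) and to finite or infinite collections of tiles by $\sigma(\{T_1,T_2,\ldots\})=\sigma(T_1)\cup\sigma(T_2)\cup\cdots$. The collections $\sigma^k(P_i)$ are the $k$-th order supertiles. The substitution matrix $M_\sigma$ is the $m\times m$ matrix with $(M_\sigma)_{ij}=\#\{T\in\sigma(P_j): T=RP_i+t \text{ for some rotation } R \text{ and } t\in\mathbb{R}^2\}$; $\sigma$ is primitive if $M_\sigma^k$ is strictly positive for some $k\ge1$. A tiling $\mathcal{T}$ is a substitution tiling with substitution $\sigma$ if for every finite subset $\mathcal{F}\subset\mathcal{T}$ there are $i,k$ such that a congruent copy of $\mathcal{F}$ is contained in the supertile $\sigma^k(P_i)$. It is a primitive substitution tiling if $\sigma$ is primitive. Statistical circular symmetry. Let $\mathcal{T}=\{T_1,T_2,\ldots\}$ be a primitive substitution tiling with substitution $\sigma$, numbered such that for all $n\ge1$ there is some $\ell\ge n$ for which the patch $\{T_1,\ldots,T_\ell\}$ is congruent to some supertile $\sigma^k(P_i)$, with $P_i$ a prototile and $k\ge1$. The tiling $\mathcal{T}$ has (is of) statistical circular symmetry if for all $0\le x<y<2\pi$ $$\lim_{n\to\infty}\frac1n\sum_{j=1}^n 1_{[x,y]}(\phi(T_j))=\frac{y-x}{2\pi}.$$ Autocorrelation. With $B_r$ the closed ball of radius $r$ around the origin and $\delta_z$ the Dirac measure at $z$, the autocorrelation of $\Lambda$ is $$\gamma_\Lambda=\lim_{r\to\infty}\frac{1}{\mathrm{vol}(B_r)}\sum_{x,y\in\Lambda\cap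 B_r}\delta_{x-y},$$ if the limit exists, the limit being in the vague topology; if the limit does not exist, there is a subsequence converging to an autocorrelation. It is a translation bounded, positive definite measure. Rotated measures. For a rotation $R$ and a measure $\mu$, $R.\mu$ is defined by $R.\mu(A)=\mu(R^{-1}A)$ for all measurable $A$; $\mu$ is of circular symmetry (circular symmetric) if $R.\mu=\mu$ for all rotations $R$. *)

theory Defs
  imports "HOL-Analysis.Analysis"
begin

text \<open>The plane \<open>\<real>\<^sup>2\<close> is the type \<^typ>\<open>complex\<close>; the rotation \<open>R\<^sub>\<alpha>\<close> about the origin is
  multiplication by \<^term>\<open>cis \<alpha>\<close>, so rotations correspond to complex numbers of norm 1.
  The prototiles \<open>P\<^sub>1, \<dots>, P\<^sub>m\<close> are indexed by a finite type \<open>'n\<close>, with \<open>m = CARD('n)\<close>.\<close>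

definition prototiles :: "('n::finite \<Rightarrow> complex set) \<Rightarrow> bool" where
  "prototiles P \<longleftrightarrow> (\<forall>i. compact (P i) \<and> P i = closure (interior (P i)))"

text \<open>\<open>Tile i u t\<close> stands for the tile \<open>u P\<^sub>i + t\<close>, where the rotor \<open>u\<close> has norm 1. The index \<open>i\<close>
  is the decoration of the tile. The rotor is stored, rather than read off from the underlying
  point set, because the orientation is not determined by that set when \<open>P\<^sub>i\<close> has a rotational
  symmetry.\<close>

datatype 'n tile = Tile (proto: 'n) (rotor: complex) (shift: complex)

definition is_tile :: "'n tile \<Rightarrow> bool" where
  "is_tile T \<longleftrightarrow> norm (rotor T) = 1"

definition tile_set :: "('n \<Rightarrow> complex set) \<Rightarrow> 'n tile \<Rightarrow> complex set" where
  "tile_set P T = (\<lambda>z. rotor T * z + shift T) ` P (proto T)"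

text \<open>\<^const>\<open>Arg2pi\<close> takes values in \<open>[0, 2\<pi>[\<close>.\<close>

definition tile_orientation :: "'n tile \<Rightarrow> real" where
  "tile_orientation T = Arg2pi (rotor T)"

text \<open>The image of a tile under the motion \<open>z \<mapsto> u z + t\<close>.\<close>

definition move_tile :: "complex \<Rightarrow> complex \<Rightarrow> 'n tile \<Rightarrow> 'n tile" where
  "move_tile u t T = Tile (proto T) (u * rotor T) (u * shift T + t)"

text \<open>All tiles are rotated and translated prototiles, without reflections, so congruence
  is with respect to orientation-preserving motions.\<close>

definition congruent_patches :: "'n tile set \<Rightarrow> 'n tile set \<Rightarrow> bool" where
  "congruent_patches F G \<longleftrightarrow> (\<exists>u t. norm u = 1 \<and> G = move_tile u t ` F)"

definition non_overlapping :: "('n \<Rightarrow> complex set) \<Rightarrow> 'n tile set \<Rightarrow> bool" where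
  "non_overlapping P F \<longleftrightarrow>
     (\<forall>z. \<forall>S\<in>F. \<forall>T\<in>F. z \<in> interior (tile_set P S) \<and> z \<in> interior (tile_set P T) \<longrightarrow> S = T)"

definition tiling :: "('n \<Rightarrow> complex set) \<Rightarrow> 'n tile set \<Rightarrow> bool" where
  "tiling P \<T> \<longleftrightarrow>
     (\<forall>T\<in>\<T>. is_tile T) \<and> (\<Union>T\<in>\<T>. tile_set P T) = UNIV \<and> non_overlapping P \<T>"

text \<open>A substitution is given by its inflation factor \<open>\<lambda>\<close> (written \<open>l\<close>) and the collections
  \<open>\<sigma> i = \<sigma>(P\<^sub>i)\<close>.\<close>

definition substitution ::
    "('n::finite \<Rightarrow> complex set) \<Rightarrow> real \<Rightarrow> ('n \<Rightarrow> 'n tile set) \<Rightarrow> bool" where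
  "substitution P l \<sigma> \<longleftrightarrow> l > 1 \<and>
     (\<forall>i. finite (\<sigma> i) \<and> (\<forall>T\<in>\<sigma> i. is_tile T) \<and> non_overlapping P (\<sigma> i) \<and>
          (\<lambda>z. l *\<^sub>R z) ` P i = (\<Union>T\<in>\<sigma> i. tile_set P T))"

definition subst_tile :: "real \<Rightarrow> ('n \<Rightarrow> 'n tile set) \<Rightarrow> 'n tile \<Rightarrow> 'n tile set" where
  "subst_tile l \<sigma> T = move_tile (rotor T) (l *\<^sub>R shift T) ` \<sigma> (proto T)"

definition subst_tiles :: "real \<Rightarrow> ('n \<Rightarrow> 'n tile set) \<Rightarrow> 'n tile set \<Rightarrow> 'n tile set" where
  "subst_tiles l \<sigma> F = (\<Union>T\<in>F. subst_tile l \<sigma> T)"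

definition supertile :: "real \<Rightarrow> ('n \<Rightarrow> 'n tile set) \<Rightarrow> nat \<Rightarrow> 'n \<Rightarrow> 'n tile set" where
  "supertile l \<sigma> k i = (subst_tiles l \<sigma> ^^ k) {Tile i 1 0}"

definition substitution_matrix :: "('n::finite \<Rightarrow> 'n tile set) \<Rightarrow> nat^'n^'n" where
  "substitution_matrix \<sigma> = (\<chi> i j. card {T \<in> \<sigma> j. proto T = i})"

definition matrix_power :: "'a::semiring_1^'n^'n \<Rightarrow> nat \<Rightarrow> 'a^'n^'n" where
  "matrix_power M k = ((\<lambda>N. M ** N) ^^ k) (mat 1)"

definition primitive_substitution :: "('n::finite \<Rightarrow> 'n tile set) \<Rightarrow> bool" where
  "primitive_substitution \<sigma> \<longleftrightarrow>
     (\<exists>k\<ge>1. \<forall>i j. matrix_power (substitution_matrix \<sigma>) k $ i $ j > 0)"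

definition substitution_tiling ::
    "('n::finite \<Rightarrow> complex set) \<Rightarrow> real \<Rightarrow> ('n \<Rightarrow> 'n tile set) \<Rightarrow> 'n tile set \<Rightarrow> bool" where
  "substitution_tiling P l \<sigma> \<T> \<longleftrightarrow>
     substitution P l \<sigma> \<and> tiling P \<T> \<and>
     (\<forall>F. finite F \<and> F \<subseteq> \<T> \<longrightarrow> (\<exists>i k G. congruent_patches F G \<and> G \<subseteq> supertile l \<sigma> k i))"

definition primitive_substitution_tiling ::
    "('n::finite \<Rightarrow> complex set) \<Rightarrow> real \<Rightarrow> ('n \<Rightarrow> 'n tile set) \<Rightarrow> 'n tile set \<Rightarrow> bool" where
  "primitive_substitution_tiling P l \<sigma> \<T> \<longleftrightarrow>
     substitution_tiling P l \<sigma> \<T> \<and> primitive_substitution \<sigma>"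

text \<open>Numberings start at 0, so \<open>\<tau> ` {..<n}\<close> is the patch of the first \<open>n\<close> tiles.\<close>

definition supertile_numbering ::
    "real \<Rightarrow> ('n \<Rightarrow> 'n tile set) \<Rightarrow> 'n tile set \<Rightarrow> (nat \<Rightarrow> 'n tile) \<Rightarrow> bool" where
  "supertile_numbering l \<sigma> \<T> \<tau> \<longleftrightarrow> bij_betw \<tau> UNIV \<T> \<and>
     (\<forall>n\<ge>1. \<exists>m\<ge>n. \<exists>k\<ge>1. \<exists>i. congruent_patches (\<tau> ` {..<m}) (supertile l \<sigma> k i))"

definition statistical_circular_symmetry ::
    "real \<Rightarrow> ('n \<Rightarrow> 'n tile set) \<Rightarrow> 'n tile set \<Rightarrow> bool" where
  "statistical_circular_symmetry l \<sigma> \<T> \<longleftrightarrow>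
     (\<exists>\<tau>. supertile_numbering l \<sigma> \<T> \<tau> \<and>
        (\<forall>x y. 0 \<le> x \<and> x < y \<and> y < 2 * pi \<longrightarrow>
           (\<lambda>n. (1 / real n) * (\<Sum>j<n. indicator {x..y} (tile_orientation (\<tau> j))))
             \<longlonglongrightarrow> (y - x) / (2 * pi)))"

definition control_points :: "('n \<Rightarrow> complex) \<Rightarrow> 'n tile set \<Rightarrow> complex set" where
  "control_points x \<T> = (\<lambda>T. rotor T * x (proto T) + shift T) ` \<T>"

text \<open>The measure \<open>1 / vol(B\<^sub>r) \<Sum>\<^bsub>x, y \<in> \<Lambda> \<inter> B\<^sub>r\<^esub> \<delta>\<^bsub>x - y\<^esub>\<close>; the sum of Dirac measures is the
  push-forward of counting measure under \<open>(x, y) \<mapsto> x - y\<close>.\<close>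

definition autocorrelation_approx :: "complex set \<Rightarrow> real \<Rightarrow> complex measure" where
  "autocorrelation_approx \<Lambda> r =
     scale_measure (ennreal (1 / measure lborel (cball (0::complex) r)))
       (distr (count_space ((\<Lambda> \<inter> cball 0 r) \<times> (\<Lambda> \<inter> cball 0 r))) borel (\<lambda>(x, y). x - y))"

definition radon_measure :: "'a::topological_space measure \<Rightarrow> bool" where
  "radon_measure \<mu> \<longleftrightarrow> sets \<mu> = sets borel \<and> (\<forall>K. compact K \<longrightarrow> emeasure \<mu> K < \<infinity>)"

definition vague_conv ::
    "('i \<Rightarrow> 'a::topological_space measure) \<Rightarrow> 'a measure \<Rightarrow> 'i filter \<Rightarrow> bool" where
  "vague_conv \<mu> \<nu> F \<longleftrightarrow>
     (\<forall>f::'a \<Rightarrow> real. continuous_on UNIV f \<and> compact (closure {z. f z \<noteq> 0}) \<longrightarrow>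
        ((\<lambda>i. integral\<^sup>L (\<mu> i) f) \<longlongrightarrow> integral\<^sup>L \<nu> f) F)"

text \<open>An autocorrelation is a vague limit along some sequence of radii tending to infinity. If
  the limit for \<open>r \<rightarrow> \<infinity>\<close> exists, it is the only autocorrelation.\<close>

definition autocorrelation :: "complex set \<Rightarrow> complex measure \<Rightarrow> bool" where
  "autocorrelation \<Lambda> \<gamma> \<longleftrightarrow> radon_measure \<gamma> \<and>
     (\<exists>r::nat \<Rightarrow> real. filterlim r at_top sequentially \<and>
        vague_conv (\<lambda>n. autocorrelation_approx \<Lambda> (r n)) \<gamma> sequentially)"

definition rotate_measure :: "real \<Rightarrow> complex measure \<Rightarrow> complex measure" where
  "rotate_measure \<theta> \<mu> = distr \<mu> borel (\<lambda>z. cis \<theta> * z)"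

definition circular_symmetric :: "complex measure \<Rightarrow> bool" where
  "circular_symmetric \<mu> \<longleftrightarrow> (\<forall>\<theta>. rotate_measure \<theta> \<mu> = \<mu>)"

end

theory Submission
  imports Defs
begin

text \<open>For an exponent q let M(q) be the matrix with entries \<open>\<Sum> u\<^sup>q\<close>, summed over the rotors u of
  the tiles of type i in the substituted prototile j. If in every supertile all tiles of one type had the
  same \<open>u\<^sup>q\<close>, only finitely many orientations would occur in the tiling. So for every \<open>q > 0\<close> some
  entry of a power of M(q) shows cancellation, primitivity spreads it to all entries, and
  \<open>M(q)\<^sup>k = o(\<lambda>\<^sup>2\<^sup>k)\<close>: orientations are equidistributed in each supertile, separately for each type.
  A sum of f(x - y) over the points of a large ball splits, up to boundary terms, into sums over
  supertiles, and these into sums over smaller supertiles. The contribution of a smaller supertile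
  is a continuous function of its rotor, so by equidistribution it hardly changes on average when f
  is rotated. Tiles near the boundary of a supertile are negligible because some tile of a
  supertile of fixed order lies in its interior, which makes their proportion decay
  geometrically.\<close>

text \<open>Counts are weighted by area. The tiles of a k-th order supertile have total area at most
  \<open>l ^ (2 * k)\<close> times that of its prototile, so the areas form a left subeigenvector of
  every matrix of type counts. After division by \<open>(l ^ k)\<^sup>2\<close> and the area of the
  starting prototile, both the number of boundary tiles and the Weyl sums shrink by a fixed factor
  below 1 every m levels, which gives the decay without eigenvector theory. The main obstacle is
  that pair sums are not additive and that the contribution of a supertile depends on its rotor
  through a function that changes with the order. Hence the two levels: k is fixed first, so that
  cutting into order k supertiles loses little. Only then is m chosen, for the now fixed finite
  family of continuous functions of the rotor. Since these functions depend on the type,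
  equidistribution is needed for each type. Statistical circular symmetry enters through the
  infinitude of the set of rotors. An autocorrelation may depend on the radii along which it is
  formed, so the comparison of f with its rotation is proved for all large balls.\<close>

section \<open>Lebesgue measure on the plane under motions and scalings\<close>

text \<open>Carries the invariance under orthogonal maps of \<open>real^2\<close> over to the
  complex plane. Coordinates match boxes with boxes of the same area, and boxes determine Lebesgue
  measure.\<close>

lemma lborel_complex_of_vec:
  "distr lborel borel (\<lambda>v::real^2. Complex (v $ 1) (v $ 2)) = lborel"
proof (rule lborel_eqI[symmetric])
  have [measurable]: "(\<lambda>v::real^2. Complex (v $ 1) (v $ 2)) \<in> borel_measurable borel"
    by (intro borel_measurable_continuous_onI) (auto simp: Complex_eq intro!: continuous_intros)
  fix l u :: complex
  assume le: "\<And>b. b \<in> Basis \<Longrightarrow> l \<bullet> b \<le> u \<bullet> b"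
  have "(\<lambda>v::real^2. Complex (v $ 1) (v $ 2)) -` box l u
      = box (vector [Re l, Im l]) (vector [Re u, Im u])"
    by (auto simp: in_box_complex_iff mem_box_cart forall_2)
  moreover have "emeasure lborel (box (vector [Re l, Im l] :: real^2) (vector [Re u, Im u]))
      = ennreal ((Re u - Re l) * (Im u - Im l))"
  proof -
    have *: "(\<Prod>b\<in>(Basis::(real^2) set). (vector [Re u, Im u] - vector [Re l, Im l] :: real^2) \<bullet> b)
      = (Re u - Re l) * (Im u - Im l)"
      by (simp add: Basis_vec_def UNIV_2 inner_axis axis_eq_axis)
    show ?thesis
      using le[of 1] le[of \<i>]
      by (subst emeasure_lborel_box)
         (auto simp: * Basis_vec_def UNIV_2 inner_axis axis_eq_axis Basis_complex_def)
  qed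
  ultimately show "emeasure (distr lborel borel (\<lambda>v::real^2. Complex (v $ 1) (v $ 2))) (box l u)
      = ennreal (\<Prod>b\<in>Basis. (u - l) \<bullet> b)"
    by (simp add: emeasure_distr Basis_complex_def)
qed simp

text \<open>The coordinate map \<open>h\<close> conjugates multiplication by \<open>u\<close> to an
  orthogonal transformation. Open sets keep all images Borel, where \<open>lborel\<close> and
  \<open>lebesgue\<close> agree; later the sets are interiors of tiles.\<close>

lemma measure_lborel_rotation:
  fixes u :: complex
  assumes u: "norm u = 1" and S: "open S" "bounded S"
  shows "measure lborel ((*) u ` S) = measure lborel S"
proof -
  define h where "h = (\<lambda>v::real^2. Complex (v $ 1) (v $ 2))"
  define R where "R = (\<lambda>v::real^2. (vector [Re (u * h v), Im (u * h v)] :: real^2))"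
  have cont: "continuous_on A h" for A
    unfolding h_def by (auto simp: Complex_eq intro!: continuous_intros)
  have [measurable]: "h \<in> borel_measurable borel"
    by (intro borel_measurable_continuous_onI cont)
  have hm: "measure lborel A = measure lborel (h -` A)" if "open A" for A
    using that by (subst lborel_complex_of_vec[symmetric]) (simp add: measure_distr h_def[symmetric])
  have hR: "h (R v) = u * h v" for v
    by (simp add: h_def R_def complex_eq_iff)
  have surj: "\<exists>v. h v = z" for z
    by (rule exI[of _ "vector [Re z, Im z]"]) (simp add: h_def)
  have inj: "h v = h w \<Longrightarrow> v = w" for v w
    by (simp add: h_def vec_eq_iff forall_2)
  have lin: "linear R"
    by (rule linearI) (auto simp: R_def h_def vec_eq_iff forall_2 algebra_simps)
  have normh: "norm (h v) = norm v" for v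
    by (simp add: h_def cmod_def norm_vec_def L2_set_def UNIV_2)
  have normR: "norm (R v) = norm v" for v
    using hR[of v] u by (metis normh norm_mult mult_1)
  have orth: "orthogonal_transformation R"
    using lin normR by (simp add: orthogonal_transformation)
  have opS: "open ((*) u ` S)"
    using u S open_times_image[of u S] by force
  have "open (h -` S)" using cont S(1) by (simp add: open_vimage)
  moreover have "bounded (h -` S)"
    using S(2) normh unfolding bounded_iff by (metis vimageE)
  ultimately have lm: "h -` S \<in> lmeasurable"
    by (simp add: lmeasurable_open)
  have "h -` ((*) u ` S) = R ` (h -` S)"
  proof (intro subset_antisym subsetI)
    fix v assume "v \<in> h -` ((*) u ` S)"
    then obtain s where s: "s \<in> S" "h v = u * s" by auto
    obtain w where "h w = s" using surj by blast
    with s hR have "h v = h (R w)" by metis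
    with inj have "v = R w" by blast
    with \<open>h w = s\<close> s show "v \<in> R ` (h -` S)" by auto
  qed (auto simp: hR)
  then have "measure lborel ((*) u ` S) = measure lborel (R ` (h -` S))"
    using hm[OF opS] by simp
  also have "\<dots> = measure lebesgue (R ` (h -` S))"
  proof -
    have "h -` ((*) u ` S) \<in> sets borel"
      using opS cont by (intro borel_open open_vimage)
    then show ?thesis using \<open>h -` ((*) u ` S) = R ` (h -` S)\<close> by simp
  qed
  also have "\<dots> = measure lebesgue (h -` S)"
    by (rule measure_orthogonal_image[OF orth lm])
  also have "\<dots> = measure lborel S"
    using \<open>open (h -` S)\<close> hm[OF S(1)] by simp
  finally show ?thesis .
qed

lemma measure_lborel_motion:
  fixes u t :: complex
  assumes u: "norm u = 1" and S: "open S" "bounded S"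
  shows "measure lborel ((\<lambda>z. u * z + t) ` S) = measure lborel S"
proof -
  have op: "open ((*) u ` S)"
    using u S open_times_image[of u S] by force
  have "(\<lambda>z. u * z + t) ` S = (\<lambda>z. 1 *\<^sub>R z + t) ` ((*) u ` S)"
    by (simp add: image_image)
  moreover have "open ((\<lambda>z. 1 *\<^sub>R z + t) ` ((*) u ` S))"
    using open_translation[OF op, of t] by (simp add: add.commute)
  ultimately have "measure lborel ((\<lambda>z. u * z + t) ` S) = measure lebesgue ((\<lambda>z. 1 *\<^sub>R z + t) ` ((*) u ` S))"
    by simp
  also have "\<dots> = measure lebesgue ((*) u ` S)"
    by (subst measure_lebesgue_affine) simp
  also have "\<dots> = measure lborel S"
    using op measure_lborel_rotation[OF assms] by simp
  finally show ?thesis .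
qed

lemma measure_lborel_scaleR:
  fixes S :: "complex set"
  assumes "open S" "c \<noteq> 0"
  shows "measure lborel ((\<lambda>z. c *\<^sub>R z) ` S) = c\<^sup>2 * measure lborel S"
proof -
  have "open ((\<lambda>z. c *\<^sub>R z) ` S)" using assms by (simp add: open_scaling)
  then have "measure lborel ((\<lambda>z. c *\<^sub>R z) ` S) = measure lebesgue ((\<lambda>z. c *\<^sub>R z + 0) ` S)"
    by simp
  also have "\<dots> = c\<^sup>2 * measure lebesgue S"
    by (subst measure_lebesgue_affine) simp
  finally show ?thesis using assms by simp
qed

lemma measure_lborel_cball_complex:
  "0 \<le> r \<Longrightarrow> measure lborel (cball (c::complex) r) = pi * r\<^sup>2"
  using content_cball[of r c] by (simp add: unit_ball_vol_2)

section \<open>Radon measures are determined by continuous functions of compact support\<close>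

lemma closed_imp_LIMSEQ_cutoff:
  fixes K :: "'a::metric_space set"
  assumes "closed K" "K \<noteq> {}"
  shows "(\<lambda>n. max 0 (1 - real n * infdist z K)) \<longlonglongrightarrow> indicat_real K z"
proof (cases "z \<in> K")
  case False
  then have d: "0 < infdist z K"
    using assms in_closed_iff_infdist_zero infdist_pos_not_in_closed by blast
  then obtain N where N: "1 \<le> real N * infdist z K"
    by (metis ex_less_of_nat_mult less_eq_real_def)
  have "max 0 (1 - real n * infdist z K) = 0" if "N \<le> n" for n
  proof -
    have "real N * infdist z K \<le> real n * infdist z K"
      using that d by (intro mult_right_mono) auto
    with N show ?thesis by linarith
  qed
  then have "(\<lambda>n. max 0 (1 - real n * infdist z K)) \<longlonglongrightarrow> 0"
    by (intro tendsto_eventually) (auto simp: eventually_sequentially)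
  with False show ?thesis by simp
qed (simp add: assms)

text \<open>Compact sets are limits of cut-off functions, and they form a generator of the Borel sets
  that is closed under intersection.\<close>

lemma radon_measure_eqI:
  fixes \<mu> \<nu> :: "'a::euclidean_space measure"
  assumes \<mu>: "radon_measure \<mu>" and \<nu>: "radon_measure \<nu>"
    and eq: "\<And>f::'a \<Rightarrow> real. continuous_on UNIV f \<Longrightarrow> compact (closure {z. f z \<noteq> 0}) \<Longrightarrow>
      integral\<^sup>L \<mu> f = integral\<^sup>L \<nu> f"
  shows "\<mu> = \<nu>"
proof -
  have lim: "(\<lambda>n. integral\<^sup>L M (\<lambda>z. max 0 (1 - real n * infdist z K))) \<longlonglongrightarrow> measure M K"
    if M: "radon_measure M" and K: "compact K" "K \<noteq> {}" for M :: "'a measure" and K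
  proof -
    have sM: "sets M = sets borel" and spM: "space M = UNIV"
      using M sets_eq_imp_space_eq[of M borel] by (auto simp: radon_measure_def)
    obtain B where B: "\<forall>z\<in>K. norm z \<le> B"
      using K compact_imp_bounded bounded_iff by metis
    have int: "integrable M (indicat_real (cball 0 (B + 1)))"
      using M by (auto simp: radon_measure_def sM spM)
    \<comment> \<open>With \<open>Suc n\<close> every cut-off vanishes at distance 1 from K, so one
      ball dominates them all. The cut-off with index 0 is the constant 1.\<close>
    have "(\<lambda>n. integral\<^sup>L M (\<lambda>z. max 0 (1 - real (Suc n) * infdist z K)))
        \<longlonglongrightarrow> integral\<^sup>L M (indicat_real K)"
    proof (rule integral_dominated_convergence[OF _ _ int])
      show "indicat_real K \<in> borel_measurable M"
        using K sM borel_compact by (intro borel_measurable_indicator) auto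
      show "(\<lambda>z. max 0 (1 - real (Suc n) * infdist z K)) \<in> borel_measurable M" for n
        by (subst measurable_cong_sets[OF sM refl])
           (intro borel_measurable_continuous_onI continuous_intros)
      show "AE z in M. (\<lambda>n. max 0 (1 - real (Suc n) * infdist z K)) \<longlonglongrightarrow> indicat_real K z"
        using LIMSEQ_Suc[OF closed_imp_LIMSEQ_cutoff[OF compact_imp_closed[OF K(1)] K(2)]] by simp
      have "max 0 (1 - real (Suc n) * infdist z K) = 0" if z: "z \<notin> cball 0 (B + 1)" for n z
      proof -
        have "1 \<le> infdist z K"
        proof (subst infdist_notempty[OF K(2)], rule cINF_greatest[OF K(2)])
          fix w assume "w \<in> K"
          then show "1 \<le> dist z w" using B z norm_triangle_sub[of z w]
            by (force simp: dist_norm)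
        qed
        then have "1 * 1 \<le> real (Suc n) * infdist z K" by (intro mult_mono) auto
        then show ?thesis by simp
      qed
      moreover have "norm (max 0 (1 - real (Suc n) * infdist z K)) \<le> 1" for n z
        using infdist_nonneg[of z K] by auto
      ultimately have "norm (max 0 (1 - real (Suc n) * infdist z K))
          \<le> indicat_real (cball 0 (B + 1)) z" for n z
        by (cases "z \<in> cball 0 (B + 1)") (simp_all only: indicator_simps norm_zero order_refl simp_thms)
      then show "AE z in M. norm (max 0 (1 - real (Suc n) * infdist z K))
          \<le> indicat_real (cball 0 (B + 1)) z" for n
        by (intro AE_I2)
    qed
    moreover have "integral\<^sup>L M (indicat_real K) = measure M K"
      using spM by simp
    ultimately show ?thesis
      by (subst filterlim_sequentially_Suc[symmetric]) simp
  qed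
  have meq: "emeasure \<mu> K = emeasure \<nu> K" if K: "compact K" for K
  proof (cases "K = {}")
    case False
    have "integral\<^sup>L \<mu> (\<lambda>z. max 0 (1 - real (Suc n) * infdist z K))
        = integral\<^sup>L \<nu> (\<lambda>z. max 0 (1 - real (Suc n) * infdist z K))" for n
    proof (rule eq)
      show "continuous_on UNIV (\<lambda>z. max 0 (1 - real (Suc n) * infdist z K))"
        by (intro continuous_intros)
      have "{z. max 0 (1 - real (Suc n) * infdist z K) \<noteq> 0} \<subseteq> {z. infdist z K \<le> 1}"
      proof
        fix z assume "z \<in> {z. max 0 (1 - real (Suc n) * infdist z K) \<noteq> 0}"
        then have "real (Suc n) * infdist z K < 1" by (auto split: if_splits simp: max_def)
        moreover have "1 * infdist z K \<le> real (Suc n) * infdist z K"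
          by (intro mult_right_mono) (auto simp: infdist_nonneg)
        ultimately show "z \<in> {z. infdist z K \<le> 1}" by simp
      qed
      moreover have "bounded {z. infdist z K \<le> 1}"
        using compact_infdist_le[OF False K, of 1] by (simp add: compact_imp_bounded)
      ultimately show "compact (closure {z. max 0 (1 - real (Suc n) * infdist z K) \<noteq> 0})"
        unfolding compact_closure by (rule bounded_subset[rotated])
    qed
    then have "(\<lambda>n. integral\<^sup>L \<mu> (\<lambda>z. max 0 (1 - real (Suc n) * infdist z K))) \<longlonglongrightarrow> measure \<nu> K"
      using LIMSEQ_Suc[OF lim[OF \<nu> K False]] by (simp only:)
    then have "measure \<mu> K = measure \<nu> K"
      using LIMSEQ_unique LIMSEQ_Suc[OF lim[OF \<mu> K False]] by blast
    moreover have "emeasure \<mu> K \<noteq> \<infinity>" "emeasure \<nu> K \<noteq> \<infinity>"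
      using \<mu> \<nu> K by (auto simp: radon_measure_def)
    ultimately show ?thesis by (simp add: emeasure_eq_ennreal_measure)
  qed simp
  have gen: "sets borel = sigma_sets UNIV (Collect (compact :: 'a set \<Rightarrow> bool))"
  proof -
    have "sets (borel :: 'a measure) = sigma_sets UNIV (Collect closed)"
      by (simp add: borel_eq_closed)
    also have "\<dots> = sigma_sets UNIV (Collect compact)"
    proof (rule sigma_sets_eqI)
      fix C :: "'a set" assume "C \<in> Collect closed"
      moreover have "C = (\<Union>n::nat. C \<inter> cball 0 (real n))"
        using real_arch_simple by (auto simp: set_eq_iff)
      moreover have "C \<inter> cball 0 (real n) \<in> sigma_sets UNIV (Collect compact)" for n
        using calculation(1) by (auto intro!: sigma_sets.Basic closed_Int_compact)
      ultimately show "C \<in> sigma_sets UNIV (Collect compact)"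
        by (metis sigma_sets.Union)
    next
      fix K :: "'a set" assume "K \<in> Collect compact"
      then show "K \<in> sigma_sets UNIV (Collect closed)"
        by (simp add: compact_imp_closed sigma_sets.Basic)
    qed
    finally show ?thesis .
  qed
  show ?thesis
  proof (rule measure_eqI_generator_eq[where E = "Collect compact" and \<Omega> = UNIV
        and A = "\<lambda>n. cball 0 (real n)"])
    show "Int_stable (Collect (compact :: 'a set \<Rightarrow> bool))"
      by (auto simp: Int_stable_def compact_Int)
    show "(\<Union>i. cball (0::'a) (real i)) = UNIV"
      using real_arch_simple by (auto simp: set_eq_iff)
    show "emeasure \<mu> (cball 0 (real i)) \<noteq> \<infinity>" for i
      using \<mu> compact_cball[of 0 "real i"] unfolding radon_measure_def by (metis less_irrefl)
  qed (use \<mu> \<nu> gen meq in \<open>auto simp: radon_measure_def\<close>)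
qed

section \<open>Motions of tiles\<close>

lemma move_tile_sel [simp]:
  "proto (move_tile u t T) = proto T"
  "rotor (move_tile u t T) = u * rotor T"
  "shift (move_tile u t T) = u * shift T + t"
  by (simp_all add: move_tile_def)

lemma move_tile_move_tile [simp]:
  "move_tile u t (move_tile v s T) = move_tile (u * v) (u * s + t) T"
  by (simp add: move_tile_def algebra_simps)

lemma move_tile_id [simp]: "move_tile 1 0 T = T"
  by (simp add: move_tile_def)

lemma inj_move_tile: "u \<noteq> 0 \<Longrightarrow> inj (move_tile u t)"
  by (auto simp: inj_on_def move_tile_def tile.expand)

lemma is_tile_move_tile: "norm u = 1 \<Longrightarrow> is_tile T \<Longrightarrow> is_tile (move_tile u t T)"
  by (simp add: is_tile_def norm_mult)

lemma tile_set_move_tile: "tile_set P (move_tile u t T) = (\<lambda>z. u * z + t) ` tile_set P T"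
  by (simp add: tile_set_def image_image algebra_simps)

lemma move_tile_proto [simp]: "move_tile (rotor T) (shift T) (Tile (proto T) 1 0) = T"
  by (simp add: move_tile_def)

lemma
  fixes u t :: complex
  assumes "u \<noteq> 0"
  shows interior_motion: "interior ((\<lambda>z. u * z + t) ` S) = (\<lambda>z. u * z + t) ` interior S"
    and closure_motion: "closure ((\<lambda>z. u * z + t) ` S) = (\<lambda>z. u * z + t) ` closure S"
proof -
  have "inj (\<lambda>z. u * z)" "bounded_linear (\<lambda>z. u * z)"
    using assms by (auto simp: inj_on_def bounded_linear_mult_right)
  then have 1: "interior ((\<lambda>z. u * z) ` S) = (\<lambda>z. u * z) ` interior S"
    and 2: "closure ((\<lambda>z. u * z) ` S) = (\<lambda>z. u * z) ` closure S"
    using interior_injective_linear_image[of "(*) u" S] closure_injective_linear_image[of "(*) u" S]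
    by (auto dest: bounded_linear.linear)
  have *: "(\<lambda>z. u * z + t) ` A = (+) t ` ((*) u ` A)" for A
    by (simp add: image_image add.commute)
  show "interior ((\<lambda>z. u * z + t) ` S) = (\<lambda>z. u * z + t) ` interior S"
    by (simp only: * interior_translation 1)
  show "closure ((\<lambda>z. u * z + t) ` S) = (\<lambda>z. u * z + t) ` closure S"
    by (simp only: * closure_translation 2)
qed

lemma interior_scale: "c \<noteq> 0 \<Longrightarrow> interior ((\<lambda>z::complex. c *\<^sub>R z) ` S) = (\<lambda>z. c *\<^sub>R z) ` interior S"
  using interior_motion[of "of_real c" 0 S] by (simp add: scaleR_conv_of_real)

lemma cball_motion:
  fixes u t :: complex
  assumes "norm u = 1"
  shows "cball (u * p + t) R = (\<lambda>z. u * z + t) ` cball p R"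
proof -
  have "u \<noteq> 0" using assms by auto
  have "z \<in> (\<lambda>z. u * z + t) ` cball p R" if "dist (u * p + t) z \<le> R" for z
  proof (rule image_eqI)
    show "z = u * ((z - t) / u) + t" using \<open>u \<noteq> 0\<close> by simp
    have "u * (p - (z - t) / u) = u * p + t - z"
      using nonzero_mult_div_cancel_left[OF \<open>u \<noteq> 0\<close>, of "z - t"]
      by (simp only: right_diff_distrib times_divide_eq_right) simp
    then have "dist (u * p + t) z = norm (u * (p - (z - t) / u))"
      by (simp add: dist_norm)
    then show "(z - t) / u \<in> cball p R"
      using that assms by (simp add: norm_mult dist_norm)
  qed
  moreover have "dist (u * p + t) (u * z + t) = dist p z" for z
    using assms by (simp add: dist_norm norm_mult flip: right_diff_distrib)
  ultimately show ?thesis by (auto simp: set_eq_iff)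
qed

subsection \<open>Iterated substitution\<close>

text \<open>Starting from an arbitrary tile, and not only from a prototile in standard position,
  makes supertiles compose: one of order k + m is the union of the order k supertiles grown from the
  tiles of one of order m.\<close>

definition supertile_of :: "real \<Rightarrow> ('n \<Rightarrow> 'n tile set) \<Rightarrow> nat \<Rightarrow> 'n tile \<Rightarrow> 'n tile set" where
  "supertile_of l \<sigma> k T = (subst_tiles l \<sigma> ^^ k) {T}"

lemma supertile_eq_supertile_of: "supertile l \<sigma> k i = supertile_of l \<sigma> k (Tile i 1 0)"
  by (simp add: supertile_def supertile_of_def)

lemma subst_tiles_UN: "subst_tiles l \<sigma> (\<Union>i\<in>I. F i) = (\<Union>i\<in>I. subst_tiles l \<sigma> (F i))"
  by (auto simp: subst_tiles_def)

lemma subst_tiles_pow_UN: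
  "(subst_tiles l \<sigma> ^^ k) (\<Union>i\<in>I. F i) = (\<Union>i\<in>I. (subst_tiles l \<sigma> ^^ k) (F i))"
  by (induction k) (simp_all add: subst_tiles_UN)

lemma subst_tiles_pow: "(subst_tiles l \<sigma> ^^ k) F = (\<Union>T\<in>F. supertile_of l \<sigma> k T)"
  using subst_tiles_pow_UN[where F = "\<lambda>T. {T}" and I = F] by (simp add: supertile_of_def)

lemma supertile_of_0 [simp]: "supertile_of l \<sigma> 0 T = {T}"
  by (simp add: supertile_of_def)

lemma supertile_of_add: "supertile_of l \<sigma> (k + m) T = (\<Union>U\<in>supertile_of l \<sigma> m T. supertile_of l \<sigma> k U)"
proof -
  have "supertile_of l \<sigma> (k + m) T = (subst_tiles l \<sigma> ^^ k) (supertile_of l \<sigma> m T)"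
    by (simp add: supertile_of_def funpow_add)
  then show ?thesis by (simp add: subst_tiles_pow)
qed

lemma supertile_of_Suc: "supertile_of l \<sigma> (Suc k) T = (\<Union>U\<in>supertile_of l \<sigma> k T. subst_tile l \<sigma> U)"
  by (simp add: supertile_of_def subst_tiles_def)

lemma subst_tile_move_tile:
  "subst_tile l \<sigma> (move_tile u t T) = move_tile u (l *\<^sub>R t) ` subst_tile l \<sigma> T"
  by (simp add: subst_tile_def image_image algebra_simps)

lemma supertile_of_move_tile:
  "supertile_of l \<sigma> k (move_tile u t T) = move_tile u (l ^ k *\<^sub>R t) ` supertile_of l \<sigma> k T"
proof (induction k)
  case (Suc k)
  then show ?case
    by (simp add: supertile_of_Suc subst_tile_move_tile image_UN)
qed simp

lemma supertile_of_eq_supertile: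
  "supertile_of l \<sigma> k T = move_tile (rotor T) (l ^ k *\<^sub>R shift T) ` supertile l \<sigma> k (proto T)"
  using supertile_of_move_tile[where T = "Tile (proto T) 1 0" and u = "rotor T" and t = "shift T"]
  by (simp add: supertile_eq_supertile_of)

lemma is_tile_nonzero: "is_tile T \<Longrightarrow> rotor T \<noteq> 0"
  by (auto simp: is_tile_def)

lemma is_tile_Tile [simp]: "is_tile (Tile i 1 0)"
  by (simp add: is_tile_def)

section \<open>Supports and non-overlapping patches\<close>

definition support :: "('n \<Rightarrow> complex set) \<Rightarrow> 'n tile set \<Rightarrow> complex set" where
  "support P F = (\<Union>T\<in>F. tile_set P T)"

lemma support_UN: "support P (\<Union>i\<in>I. F i) = (\<Union>i\<in>I. support P (F i))"
  by (auto simp: support_def)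

lemma support_mono: "F \<subseteq> G \<Longrightarrow> support P F \<subseteq> support P G"
  by (auto simp: support_def)

lemma support_move: "support P (move_tile u t ` F) = (\<lambda>z. u * z + t) ` support P F"
  by (auto simp: support_def tile_set_move_tile)

lemma non_overlappingD:
  assumes "non_overlapping P F" "S \<in> F" "T \<in> F"
    "z \<in> interior (tile_set P S)" "z \<in> interior (tile_set P T)"
  shows "S = T"
  using assms unfolding non_overlapping_def by blast

lemma non_overlapping_subset: "non_overlapping P F \<Longrightarrow> G \<subseteq> F \<Longrightarrow> non_overlapping P G"
  unfolding non_overlapping_def by blast

lemma non_overlapping_move:
  assumes "u \<noteq> 0" "non_overlapping P F"
  shows "non_overlapping P (move_tile u t ` F)"
  using assms unfolding non_overlapping_def
  by (auto simp: tile_set_move_tile interior_motion inj_on_def) metis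

locale substitution_system =
  fixes P :: "'n::finite \<Rightarrow> complex set" and l :: real and \<sigma> :: "'n \<Rightarrow> 'n tile set"
    and x :: "'n \<Rightarrow> complex"
  assumes prototiles: "prototiles P" and substitution: "substitution P l \<sigma>"
    and point_in_prototile: "x i \<in> P i"
begin

lemma l_gt_1: "l > 1"
  using substitution by (simp add: substitution_def)

lemma l_nonzero [simp]: "l \<noteq> 0"
  using l_gt_1 by auto

lemma compact_prototile: "compact (P i)" and prototile_eq: "closure (interior (P i)) = P i"
  using prototiles by (auto simp: prototiles_def)

abbreviation "super \<equiv> supertile_of l \<sigma>"

lemma is_tile_supertile_of: "is_tile T \<Longrightarrow> S \<in> super k T \<Longrightarrow> is_tile S"
proof (induction k arbitrary: S)
  case (Suc k)
  then obtain U V where "U \<in> super k T" "V \<in> \<sigma> (proto U)"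
      "S = move_tile (rotor U) (l *\<^sub>R shift U) V"
    by (auto simp: supertile_of_Suc subst_tile_def)
  with Suc show ?case
    using substitution is_tile_move_tile by (auto simp: substitution_def is_tile_def norm_mult)
qed auto

lemma finite_supertile_of: "finite (super k T)"
proof (induction k)
  case (Suc k)
  then show ?case
    using substitution by (auto simp: supertile_of_Suc subst_tile_def substitution_def)
qed auto

lemma tile_set_eq: "is_tile T \<Longrightarrow> closure (interior (tile_set P T)) = tile_set P T"
  by (simp add: tile_set_def interior_motion closure_motion is_tile_nonzero prototile_eq)

lemma compact_tile_set: "compact (tile_set P T)"
  unfolding tile_set_def by (intro compact_continuous_image continuous_intros compact_prototile)

lemma support_subst_tile: "support P (subst_tile l \<sigma> T) = (\<lambda>z. l *\<^sub>R z) ` tile_set P T"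
proof -
  have "support P (\<sigma> (proto T)) = (\<lambda>z. l *\<^sub>R z) ` P (proto T)"
    using substitution by (simp add: substitution_def support_def)
  then show ?thesis
    by (simp add: subst_tile_def support_move tile_set_def image_image algebra_simps)
qed

lemma support_supertile_of: "support P (super k T) = (\<lambda>z. l ^ k *\<^sub>R z) ` tile_set P T"
proof (induction k)
  case 0
  then show ?case by (simp add: support_def)
next
  case (Suc k)
  have "support P (super (Suc k) T) = (\<Union>U\<in>super k T. (\<lambda>z. l *\<^sub>R z) ` tile_set P U)"
    by (simp add: supertile_of_Suc support_UN support_subst_tile)
  also have "\<dots> = (\<lambda>z. l *\<^sub>R z) ` support P (super k T)"
    by (auto simp: support_def)
  finally show ?case by (simp add: Suc image_image)
qed

text \<open>The supports are the tiles U and V inflated by the same factor, so a common interior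
  point scales back to one of U and V.\<close>

lemma interior_support_supertile_of_disjoint:
  assumes "non_overlapping P F" "U \<in> F" "V \<in> F"
    "z \<in> interior (support P (super k U))" "z \<in> interior (support P (super k V))"
  shows "U = V"
  using assms(4,5) non_overlappingD[OF assms(1-3)] by (auto simp: support_supertile_of interior_scale)

lemma interior_tile_subset_support:
  "T \<in> F \<Longrightarrow> interior (tile_set P T) \<subseteq> interior (support P F)"
  by (intro interior_mono) (auto simp: support_def)

lemma non_overlapping_subst_tile: "is_tile T \<Longrightarrow> non_overlapping P (subst_tile l \<sigma> T)"
  unfolding subst_tile_def using substitution
  by (intro non_overlapping_move is_tile_nonzero) (auto simp: substitution_def)

lemma supertile_of_1: "super 1 T = subst_tile l \<sigma> T"
  using supertile_of_Suc[of l \<sigma> 0 T] by simp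

text \<open>Overlapping tiles of order k + 1 have parents whose inflations overlap, so the parents
  agree by induction. Siblings do not overlap by the definition of a substitution.\<close>

lemma non_overlapping_supertile_of: "is_tile T \<Longrightarrow> non_overlapping P (super k T)"
proof (induction k)
  case 0
  then show ?case by (simp add: non_overlapping_def)
next
  case (Suc k)
  show ?case
    unfolding non_overlapping_def
  proof (intro allI ballI impI)
    fix z S S'
    assume S: "S \<in> super (Suc k) T" "S' \<in> super (Suc k) T"
      and z: "z \<in> interior (tile_set P S) \<and> z \<in> interior (tile_set P S')"
    obtain U U' where U: "U \<in> super k T" "S \<in> super 1 U" and U': "U' \<in> super k T" "S' \<in> super 1 U'"
      using S by (auto simp: supertile_of_Suc supertile_of_1)
    have "U = U'"
      using interior_support_supertile_of_disjoint[OF Suc.IH[OF Suc.prems] U(1) U'(1)]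
        interior_tile_subset_support[OF U(2)] interior_tile_subset_support[OF U'(2)] z by blast
    moreover have "is_tile U"
      using is_tile_supertile_of Suc.prems U by blast
    ultimately show "S = S'"
      using non_overlappingD[OF non_overlapping_subst_tile] U U' z by (metis supertile_of_1)
  qed
qed

text \<open>A prototile contains its chosen point and is the closure of its interior.\<close>

lemma interior_tile_nonempty: "is_tile T \<Longrightarrow> interior (tile_set P T) \<noteq> {}"
proof
  assume T: "is_tile T" and "interior (tile_set P T) = {}"
  then have "tile_set P T = {}" using tile_set_eq[OF T] by simp
  then show False using point_in_prototile by (auto simp: tile_set_def)
qed

text \<open>A common tile T would put its nonempty interior into both supports. This makes unions
  over smaller supertiles disjoint, so that counts and sums split.\<close>

lemma supertile_of_disjoint:
  assumes "non_overlapping P F" "\<And>T. T \<in> F \<Longrightarrow> is_tile T" "U \<in> F" "V \<in> F"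
    "T \<in> super k U" "T \<in> super k V"
  shows "U = V"
proof -
  obtain z where "z \<in> interior (tile_set P T)"
    using interior_tile_nonempty is_tile_supertile_of assms by blast
  with interior_support_supertile_of_disjoint[OF assms(1,3,4)] interior_tile_subset_support assms(5,6)
  show ?thesis by blast
qed

lemma supertile_of_disjoint_nested:
  assumes "is_tile W" "U \<in> super m W" "V \<in> super m W" "T \<in> super k U" "T \<in> super k V"
  shows "U = V"
  using supertile_of_disjoint[OF non_overlapping_supertile_of[OF assms(1)] _ assms(2-5)] is_tile_supertile_of[OF assms(1)] by blast

text \<open>Uses that every tile is the closure of its interior.\<close>

lemma mem_of_interior_support:
  assumes "non_overlapping P X" "S \<subseteq> X" "\<And>T. T \<in> X \<Longrightarrow> is_tile T"
    "T \<in> X" "y \<in> tile_set P T" "y \<in> interior (support P S)"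
  shows "T \<in> S"
proof -
  \<comment> \<open>The point y may lie on the boundary of T, and an interior point of T near it on
    the boundary of some V in S. Two small moves therefore lead to a common interior point of V and
    T.\<close>
  have "y \<in> closure (interior (tile_set P T))"
    using assms tile_set_eq by auto
  then obtain z where z: "z \<in> interior (tile_set P T)" "z \<in> interior (support P S)"
    using assms(6) open_Int_closure_eq_empty[of "interior (support P S)" "interior (tile_set P T)"]
    by blast
  then obtain V where V: "V \<in> S" "z \<in> tile_set P V"
    using interior_subset by (fastforce simp: support_def)
  then have "z \<in> closure (interior (tile_set P V))"
    using assms tile_set_eq by blast
  then obtain w where "w \<in> interior (tile_set P V)" "w \<in> interior (tile_set P T)"
    using z open_Int_closure_eq_empty[of "interior (tile_set P T)" "interior (tile_set P V)"]
    by blast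
  then have "V = T"
    using non_overlappingD[OF assms(1)] V assms by blast
  with V show ?thesis by simp
qed

end

section \<open>Cancellation of unit vectors and geometric decay\<close>

text \<open>Equality in the triangle inequality forces two unit vectors to coincide, so
  \<open>f v + f w\<close> is already shorter than 2.\<close>

lemma norm_sum_less_card:
  fixes f :: "'a \<Rightarrow> complex"
  assumes "finite A" "\<And>z. z \<in> A \<Longrightarrow> norm (f z) = 1" "v \<in> A" "w \<in> A" "f v \<noteq> f w"
  shows "norm (sum f A) < real (card A)"
proof -
  have "v \<noteq> w" using assms by auto
  have "norm (f v + f w) \<noteq> norm (f v) + norm (f w)"
  proof
    assume "norm (f v + f w) = norm (f v) + norm (f w)"
    then have "norm (f v) *\<^sub>R f w = norm (f w) *\<^sub>R f v"
      by (simp only: norm_triangle_eq)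
    with assms show False by simp
  qed
  then have less: "norm (f v + f w) < 2"
    using norm_triangle_ineq[of "f v" "f w"] assms by simp
  have "sum f A = (f v + f w) + sum f (A - {v, w})"
    using assms \<open>v \<noteq> w\<close> by (simp add: sum_diff)
  then have "norm (sum f A) \<le> norm (f v + f w) + norm (sum f (A - {v, w}))"
    by (metis norm_triangle_ineq)
  also have "\<dots> < 2 + real (card (A - {v, w}))"
    using less assms sum_norm_le[of "A - {v, w}" f "\<lambda>_. 1"] by fastforce
  also have "card (A - {v, w}) = card A - 2"
    using assms \<open>v \<noteq> w\<close> by (subst card_Diff_subset) auto
  also have "2 + real (card A - 2) = real (card A)"
    using assms \<open>v \<noteq> w\<close> card_mono[of A "{v, w}"] by simp
  finally show ?thesis .
qed

text \<open>The step is assumed for every bound \<open>B'\<close>, so that it can be iterated, and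
  is applied at \<open>k - m\<close>, so that the bound holds for all large k and not only along
  multiples of m. It serves both for boundary tiles and for Weyl sums.\<close>

lemma contraction_eventually_less:
  fixes f :: "nat \<Rightarrow> 'a \<Rightarrow> real"
  assumes c: "0 \<le> c" "c < 1" and B: "0 \<le> B" "\<And>k i. f k i \<le> B"
    and step: "\<And>k B'. k0 \<le> k \<Longrightarrow> 0 \<le> B' \<Longrightarrow> (\<And>i. f k i \<le> B') \<Longrightarrow> (\<And>i. f (k + m) i \<le> c * B')"
    and "0 < e"
  shows "\<forall>\<^sub>F k in sequentially. \<forall>i. f k i < e"
proof -
  have *: "\<forall>k\<ge>k0 + n * m. \<forall>i. f k i \<le> c ^ n * B" for n
  proof (induction n)
    case (Suc n)
    show ?case
    proof (intro allI impI)
      fix k i assume k: "k0 + Suc n * m \<le> k"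
      then have "f (k - m + m) i \<le> c * (c ^ n * B)"
        using Suc c B by (intro step) (auto simp: le_diff_conv2)
      with k show "f k i \<le> c ^ Suc n * B" by (simp add: algebra_simps)
    qed
  qed (use B in simp)
  have "(\<lambda>n. c ^ n * B) \<longlonglongrightarrow> 0 * B"
    using c by (intro tendsto_intros LIMSEQ_power_zero) auto
  then have "\<forall>\<^sub>F n in sequentially. c ^ n * B < e"
    using \<open>0 < e\<close> by (intro order_tendstoD) auto
  then obtain n where "c ^ n * B < e"
    by (auto simp: eventually_sequentially)
  with * show ?thesis
    unfolding eventually_sequentially by (meson le_less_trans)
qed

section \<open>Control points, areas and packing bounds\<close>

definition control_point :: "('n \<Rightarrow> complex) \<Rightarrow> 'n tile \<Rightarrow> complex" where
  "control_point x T = rotor T * x (proto T) + shift T"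

lemma control_points_eq: "control_points x F = control_point x ` F"
  by (simp add: control_points_def control_point_def)

lemma control_point_move: "control_point x (move_tile u t T) = u * control_point x T + t"
  by (simp add: control_point_def algebra_simps)

lemma fmeasurable_bounded:
  fixes S :: "'a::euclidean_space set"
  assumes "bounded S" "S \<in> sets borel"
  shows "S \<in> fmeasurable lborel"
  using assms emeasure_bounded_finite[OF assms(1)] by (intro fmeasurableI) simp_all

context substitution_system
begin

lemma eventually_le_l_pow: "\<forall>\<^sub>F k in sequentially. a \<le> l ^ k"
proof -
  obtain n where "a < l ^ n" using real_arch_pow[OF l_gt_1] by blast
  moreover have "l ^ n \<le> l ^ k" if "n \<le> k" for k
    using that l_gt_1 by (intro power_increasing) auto
  ultimately show ?thesis unfolding eventually_sequentially by (meson less_imp_le order_trans)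
qed

abbreviation "cp \<equiv> control_point x"

lemma cp_in_tile: "cp T \<in> tile_set P T"
  using point_in_prototile by (auto simp: control_point_def tile_set_def)

definition area :: "'n \<Rightarrow> real" where
  "area i = measure lborel (interior (P i))"

lemma bounded_interior: "bounded (interior (P i))"
  using compact_prototile compact_imp_bounded bounded_interior by blast

lemma area_pos: "0 < area i"
proof -
  have "interior (P i) \<noteq> {}"
    using interior_tile_nonempty[OF is_tile_Tile[of i]] by (simp add: tile_set_def)
  then obtain z e where e: "0 < e" "ball z e \<subseteq> interior (P i)"
    by (meson all_not_in_conv open_contains_ball open_interior)
  have "measure lborel (ball z e) \<le> measure lborel (interior (P i))"
    using e bounded_interior
    by (intro measure_mono_fmeasurable) (auto intro!: fmeasurable_bounded)
  with e show ?thesis unfolding area_def using content_ball_pos[of e z] by linarith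
qed

definition "min_area = Min (range area)"
definition "max_area = Max (range area)"
definition "diam = Max (range (\<lambda>i. diameter (P i)))"

lemma min_area_le: "min_area \<le> area i" and le_max_area: "area i \<le> max_area"
  by (auto simp: min_area_def max_area_def)

lemma min_area_pos [simp]: "0 < min_area"
  using area_pos by (auto simp: min_area_def)

lemma min_area_nonzero [simp]: "min_area \<noteq> 0"
  using min_area_pos by linarith

lemma max_area_pos [simp]: "0 < max_area"
  using area_pos le_max_area less_le_trans by blast

lemma diam_nonneg [simp]: "0 \<le> diam"
proof -
  have "0 \<le> diameter (P undefined)"
    using compact_prototile compact_imp_bounded diameter_ge_0 by blast
  also have "\<dots> \<le> diam" by (auto simp: diam_def)
  finally show ?thesis .
qed

lemma dist_tile_le:
  assumes "is_tile T" "y \<in> tile_set P T" "z \<in> tile_set P T"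
  shows "dist y z \<le> diam"
proof -
  obtain y' z' where yz: "y' \<in> P (proto T)" "z' \<in> P (proto T)"
      "y = rotor T * y' + shift T" "z = rotor T * z' + shift T"
    using assms by (auto simp: tile_set_def)
  have "dist y z = norm (rotor T * (y' - z'))"
    by (simp add: dist_norm yz algebra_simps)
  also have "\<dots> = dist y' z'"
    using assms(1) by (simp add: norm_mult is_tile_def dist_norm)
  also have "\<dots> \<le> diameter (P (proto T))"
    using diameter_bounded_bound compact_prototile compact_imp_bounded yz by blast
  also have "\<dots> \<le> diam" by (auto simp: diam_def)
  finally show ?thesis .
qed

lemma measure_interior_tile:
  "is_tile T \<Longrightarrow> measure lborel (interior (tile_set P T)) = area (proto T)"
  by (simp add: tile_set_def interior_motion is_tile_nonzero area_def
      measure_lborel_motion is_tile_def bounded_interior)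

lemma bounded_interior_tile: "bounded (interior (tile_set P T))"
  using compact_tile_set compact_imp_bounded Elementary_Metric_Spaces.bounded_interior by blast

lemma packing:
  assumes "finite F" "non_overlapping P F" "\<And>T. T \<in> F \<Longrightarrow> is_tile T"
    "\<And>T. T \<in> F \<Longrightarrow> interior (tile_set P T) \<subseteq> B" "B \<in> fmeasurable lborel"
  shows "(\<Sum>T\<in>F. area (proto T)) \<le> measure lborel B"
proof -
  have fin: "interior (tile_set P T) \<in> fmeasurable lborel" for T
    using bounded_interior_tile by (auto intro!: fmeasurable_bounded)
  have "(\<Sum>T\<in>F. area (proto T)) = (\<Sum>T\<in>F. measure lborel (interior (tile_set P T)))"
    using assms measure_interior_tile by simp
  also have "\<dots> = measure lborel (\<Union>T\<in>F. interior (tile_set P T))"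
  proof (rule measure_finite_Union[symmetric])
    show "disjoint_family_on (\<lambda>T. interior (tile_set P T)) F"
      using non_overlappingD[OF assms(2)] by (auto simp: disjoint_family_on_def)
    show "emeasure lborel (interior (tile_set P T)) \<noteq> \<infinity>" for T
      using emeasure_bounded_finite[OF bounded_interior_tile[of T]] by simp
  qed (use assms in auto)
  also have "\<dots> \<le> measure lborel B"
    using assms by (intro measure_mono_fmeasurable) auto
  finally show ?thesis .
qed

lemma card_packing:
  assumes "finite F" "non_overlapping P F" "\<And>T. T \<in> F \<Longrightarrow> is_tile T"
    "\<And>T. T \<in> F \<Longrightarrow> interior (tile_set P T) \<subseteq> B" "B \<in> fmeasurable lborel"
  shows "real (card F) \<le> measure lborel B / min_area"
proof -
  have "real (card F) * min_area \<le> (\<Sum>T\<in>F. area (proto T))"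
    using sum_mono[of F "\<lambda>_. min_area" "\<lambda>T. area (proto T)"] min_area_le by simp
  also have "\<dots> \<le> measure lborel B" by (rule packing[OF assms])
  finally show ?thesis by (simp add: field_simps)
qed

lemma tile_subset_cball:
  assumes "is_tile T" "cp T \<in> cball c r"
  shows "tile_set P T \<subseteq> cball c (r + diam)"
proof
  fix z assume "z \<in> tile_set P T"
  then have "dist (cp T) z \<le> diam" using dist_tile_le[OF assms(1) cp_in_tile] by simp
  with assms(2) show "z \<in> cball c (r + diam)"
    using dist_triangle[of c z "cp T"] by simp
qed

text \<open>Tiles are counted, not points, so tiles sharing a control point cause no trouble: their
  disjoint interiors all lie in the ball enlarged by \<open>diam\<close>.\<close>

lemma cp_packing:
  assumes "non_overlapping P F" "\<And>T. T \<in> F \<Longrightarrow> is_tile T" "0 \<le> r"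
    "\<And>T. T \<in> F \<Longrightarrow> cp T \<in> cball c r"
  shows "finite F" "real (card F) \<le> pi * (r + diam)\<^sup>2 / min_area"
proof -
  \<comment> \<open>F is not yet known to be finite; a uniform bound for its finite subfamilies
    gives both claims.\<close>
  have *: "real (card G) \<le> pi * (r + diam)\<^sup>2 / min_area" if "G \<subseteq> F" "finite G" for G
  proof -
    have "interior (tile_set P T) \<subseteq> cball c (r + diam)" if "T \<in> G" for T
      using tile_subset_cball[OF assms(2) assms(4)] \<open>G \<subseteq> F\<close> that interior_subset by blast
    then have "real (card G) \<le> measure lborel (cball c (r + diam)) / min_area"
      using that assms non_overlapping_subset[OF assms(1)]
      by (intro card_packing) (auto intro!: fmeasurable_bounded)
    then show ?thesis using assms by (simp add: measure_lborel_cball_complex)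
  qed
  have "card G \<le> nat \<lceil>pi * (r + diam)\<^sup>2 / min_area\<rceil>" if "G \<subseteq> F" "finite G" for G
    using *[OF that] by linarith
  then show fin: "finite F"
    by (metis finite_if_finite_subsets_card_bdd)
  then show "real (card F) \<le> pi * (r + diam)\<^sup>2 / min_area"
    using * by blast
qed

text \<open>The areas are those of interiors, and tile boundaries may have positive measure, so an
  inequality is what packing gives.\<close>

lemma sum_area_supertile_of:
  assumes "is_tile T"
  shows "(\<Sum>U\<in>super k T. area (proto U)) \<le> (l ^ k)\<^sup>2 * area (proto T)"
proof -
  have "(\<Sum>U\<in>super k T. area (proto U)) \<le> measure lborel (interior (support P (super k T)))"
  proof (rule packing)
    have "bounded (interior (support P (super k T)))"
      using finite_supertile_of compact_tile_set
      by (intro Elementary_Metric_Spaces.bounded_interior compact_imp_bounded)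
         (auto simp: support_def intro!: compact_UN)
    then show "interior (support P (super k T)) \<in> fmeasurable lborel"
      by (auto intro!: fmeasurable_bounded)
  qed (use finite_supertile_of non_overlapping_supertile_of is_tile_supertile_of assms interior_tile_subset_support in auto)
  also have "\<dots> = (l ^ k)\<^sup>2 * area (proto T)"
    using assms by (simp add: support_supertile_of interior_scale measure_lborel_scaleR measure_interior_tile)
  finally show ?thesis .
qed

lemma card_supertile_of:
  assumes "is_tile T"
  shows "real (card (super k T)) \<le> max_area / min_area * (l ^ k)\<^sup>2"
proof -
  have "real (card (super k T)) * min_area \<le> (\<Sum>U\<in>super k T. area (proto U))"
    using sum_mono[of "super k T" "\<lambda>_. min_area" "\<lambda>T. area (proto T)"] min_area_le by simp
  also have "\<dots> \<le> (l ^ k)\<^sup>2 * area (proto T)" by (rule sum_area_supertile_of[OF assms])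
  also have "\<dots> \<le> (l ^ k)\<^sup>2 * max_area" by (intro mult_left_mono le_max_area) auto
  finally show ?thesis by (simp add: field_simps)
qed

subsection \<open>Tiles near the boundary of a supertile\<close>

text \<open>The margin R is required around every point of the tile, hence around its control point
  wherever that was chosen. Differences shorter than R from that control point then stay within the
  supertile.\<close>

definition inner_tiles :: "real \<Rightarrow> nat \<Rightarrow> 'n tile \<Rightarrow> 'n tile set" where
  "inner_tiles R k U = {T \<in> super k U. \<forall>p\<in>tile_set P T. cball p R \<subseteq> support P (super k U)}"

definition boundary_tiles :: "real \<Rightarrow> nat \<Rightarrow> 'n tile \<Rightarrow> 'n tile set" where
  "boundary_tiles R k U = super k U - inner_tiles R k U"

lemma boundary_tiles_move:
  assumes "norm u = 1"
  shows "boundary_tiles R k (move_tile u t T) = move_tile u (l ^ k *\<^sub>R t) ` boundary_tiles R k T"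
proof -
  have "u \<noteq> 0" using assms by auto
  then have inj: "inj (\<lambda>z. u * z + l ^ k *\<^sub>R t)" by (auto simp: inj_on_def)
  define Q where "Q = (\<lambda>U S. \<forall>p\<in>tile_set P S. cball p R \<subseteq> support P (super k U))"
  have "Q (move_tile u t T) (move_tile u (l ^ k *\<^sub>R t) S) \<longleftrightarrow> Q T S" for S
    by (simp add: Q_def supertile_of_move_tile support_move tile_set_move_tile
        cball_motion[OF assms] inj_image_subset_iff[OF inj])
  moreover have "boundary_tiles R k U = {S \<in> super k U. \<not> Q U S}" for U
    by (auto simp: boundary_tiles_def inner_tiles_def Q_def)
  ultimately show ?thesis
    by (auto simp: supertile_of_move_tile)
qed

lemma card_boundary_tiles: "is_tile T \<Longrightarrow> card (boundary_tiles R k T) = card (boundary_tiles R k (Tile (proto T) 1 0))"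
  using boundary_tiles_move[of "rotor T" R k "shift T" "Tile (proto T) 1 0"]
    card_image[OF inj_on_subset[OF inj_move_tile[of "rotor T" ] subset_UNIV]]
  by (simp add: is_tile_def is_tile_nonzero)

lemma support_supertile_of_mono: "U \<in> super m T \<Longrightarrow> support P (super k U) \<subseteq> support P (super (k + m) T)"
  by (intro support_mono) (auto simp: supertile_of_add)

text \<open>Supports grow along nested supertiles, so a tile that is inner for the smaller one stays
  inner for the larger.\<close>

lemma boundary_tiles_subset: "boundary_tiles R (k + m) T \<subseteq> (\<Union>U\<in>super m T. boundary_tiles R k U)"
proof
  fix S assume "S \<in> boundary_tiles R (k + m) T"
  moreover from this obtain U where "U \<in> super m T" "S \<in> super k U"
    by (auto simp: boundary_tiles_def supertile_of_add)
  ultimately show "S \<in> (\<Union>U\<in>super m T. boundary_tiles R k U)"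
    using support_supertile_of_mono[of U m T k] by (fastforce simp: boundary_tiles_def inner_tiles_def)
qed

lemma finite_boundary_tiles [simp]: "finite (boundary_tiles R k T)"
  by (simp add: boundary_tiles_def finite_supertile_of)

text \<open>Inflation turns a ball of radius e in the prototile into one of radius
  \<open>l ^ m * e\<close>, eventually at least \<open>diam + 1\<close>; a tile containing its
  centre then has margin 1. After k further substitutions the margin is \<open>l ^ k\<close>, which
  beats any prescribed R.\<close>

lemma exists_interior_tile:
  "\<exists>m. \<forall>i. \<exists>U\<in>super m (Tile i 1 0). \<forall>p\<in>tile_set P U. cball p 1 \<subseteq> support P (super m (Tile i 1 0))"
proof -
  have "\<forall>\<^sub>F m in sequentially. \<exists>U\<in>super m (Tile i 1 0).
      \<forall>p\<in>tile_set P U. cball p 1 \<subseteq> support P (super m (Tile i 1 0))" for i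
  proof -
    have "interior (P i) \<noteq> {}"
      using interior_tile_nonempty[OF is_tile_Tile[of i]] by (simp add: tile_set_def)
    then obtain z e where e: "0 < e" "cball z e \<subseteq> P i"
      by (meson all_not_in_conv mem_interior_cball)
    show ?thesis
      using eventually_le_l_pow[of "(diam + 1) / e"]
    proof eventually_elim
      case (elim m)
      have sup: "support P (super m (Tile i 1 0)) = (\<lambda>w. l ^ m *\<^sub>R w) ` P i"
        by (simp add: support_supertile_of tile_set_def)
      moreover have "z \<in> P i" using e by auto
      ultimately have "l ^ m *\<^sub>R z \<in> support P (super m (Tile i 1 0))" by blast
      then obtain U where U: "U \<in> super m (Tile i 1 0)" "l ^ m *\<^sub>R z \<in> tile_set P U"
        by (auto simp: support_def)
      have "is_tile U" by (rule is_tile_supertile_of[OF is_tile_Tile U(1)])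
      show ?case
      proof (intro bexI[OF _ U(1)] ballI subsetI)
        fix p w assume p: "p \<in> tile_set P U" and w: "w \<in> cball p 1"
        have "dist (l ^ m *\<^sub>R z) w \<le> diam + 1"
          using dist_tile_le[OF \<open>is_tile U\<close> U(2) p] w dist_triangle[of "l ^ m *\<^sub>R z" w p] by simp
        also have "\<dots> \<le> l ^ m * e" using elim e by (simp add: field_simps)
        finally have "w \<in> cball (l ^ m *\<^sub>R z) (l ^ m * e)" by simp
        also have "\<dots> = (\<lambda>w. l ^ m *\<^sub>R w) ` cball z e"
          using cball_scale[of "l ^ m" z e] l_gt_1 by simp
        also have "\<dots> \<subseteq> support P (super m (Tile i 1 0))"
          using e unfolding sup by blast
        finally show "w \<in> support P (super m (Tile i 1 0))" .
      qed
    qed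
  qed
  then have "\<forall>\<^sub>F m in sequentially. \<forall>i. \<exists>U\<in>super m (Tile i 1 0).
      \<forall>p\<in>tile_set P U. cball p 1 \<subseteq> support P (super m (Tile i 1 0))"
    by (rule eventually_all_finite)
  then show ?thesis by (auto simp: eventually_sequentially)
qed

text \<open>Among the tiles of an order m supertile, one tile \<open>U0\<close> has margin 1. Once
  \<open>R \<le> l ^ k\<close>, everything grown from \<open>U0\<close> in k steps is inner, so
  boundary tiles come only from the other tiles. Each block of m levels thus removes a fixed
  fraction of the area.\<close>

lemma eventually_few_boundary_tiles:
  assumes "0 < e"
  shows "\<forall>\<^sub>F k in sequentially. \<forall>i. real (card (boundary_tiles R k (Tile i 1 0))) < e * (l ^ k)\<^sup>2"
proof -
  obtain m where m: "\<And>i. \<exists>U\<in>super m (Tile i 1 0).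
      \<forall>p\<in>tile_set P U. cball p 1 \<subseteq> support P (super m (Tile i 1 0))"
    using exists_interior_tile by blast
  obtain k0 where k0: "\<And>k. k0 \<le> k \<Longrightarrow> R \<le> l ^ k"
    using eventually_le_l_pow unfolding eventually_sequentially by blast
  \<comment> \<open>The subtracted quotient bounds the area share of \<open>U0\<close> from below:
    at least \<open>min_area\<close> out of at most
    \<open>(l ^ m)\<^sup>2 * max_area\<close>.\<close>
  define c where "c = 1 - min_area / ((l ^ m)\<^sup>2 * max_area)"
  define f where "f = (\<lambda>k i. real (card (boundary_tiles R k (Tile i 1 0))) / ((l ^ k)\<^sup>2 * area i))"
  have l2: "1 \<le> (l ^ m)\<^sup>2" using l_gt_1 by simp
  have "min_area \<le> max_area" using min_area_le le_max_area order_trans by blast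
  then have "1 * min_area \<le> (l ^ m)\<^sup>2 * max_area" using l2 by (intro mult_mono) (auto simp: less_imp_le)
  then have c: "0 \<le> c" "c < 1"
    by (auto simp: c_def field_simps)
  have "\<forall>\<^sub>F k in sequentially. \<forall>i. f k i < e / max_area"
  proof (rule contraction_eventually_less[OF c, where m = m and ?k0.0 = k0])
    show "0 < e / max_area" "0 \<le> max_area / min_area / min_area" using assms by (simp_all add: less_imp_le)
    show "f k i \<le> max_area / min_area / min_area" for k i
    proof -
      have "card (boundary_tiles R k (Tile i 1 0)) \<le> card (super k (Tile i 1 0))"
        by (intro card_mono finite_supertile_of) (auto simp: boundary_tiles_def)
      then have "real (card (boundary_tiles R k (Tile i 1 0))) \<le> max_area / min_area * (l ^ k)\<^sup>2 * 1"
        using card_supertile_of[OF is_tile_Tile[of i], of k] by linarith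
      also have "\<dots> \<le> max_area / min_area * (l ^ k)\<^sup>2 * (area i / min_area)"
        using min_area_le[of i] by (intro mult_left_mono) (auto simp: less_imp_le)
      also have "\<dots> = max_area / min_area / min_area * ((l ^ k)\<^sup>2 * area i)"
        by simp
      finally show ?thesis
        using area_pos[of i] by (simp add: f_def divide_le_eq)
    qed
  next
    fix k B i assume k: "k0 \<le> k" and B: "0 \<le> B" "\<And>i. f k i \<le> B"
    let ?T = "Tile i 1 0 :: 'n tile"
    obtain U0 where U0: "U0 \<in> super m ?T" "\<And>p. p \<in> tile_set P U0 \<Longrightarrow> cball p 1 \<subseteq> support P (super m ?T)"
      using m by blast
    have tile: "U \<in> super m ?T \<Longrightarrow> is_tile U" for U
      by (rule is_tile_supertile_of[OF is_tile_Tile])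
    have "super k U0 \<subseteq> inner_tiles R (k + m) ?T"
    proof
      fix S assume S: "S \<in> super k U0"
      have "cball p R \<subseteq> support P (super (k + m) ?T)" if "p \<in> tile_set P S" for p
      proof -
        have "p \<in> support P (super k U0)" using that S by (auto simp: support_def)
        then obtain q where q: "q \<in> tile_set P U0" "p = l ^ k *\<^sub>R q" by (auto simp: support_supertile_of)
        have "cball p R \<subseteq> cball p (l ^ k)" using k0[OF k] by auto
        also have "\<dots> = (\<lambda>w. l ^ k *\<^sub>R w) ` cball q 1"
          using cball_scale[of "l ^ k" q 1] l_gt_1 q by simp
        also have "\<dots> \<subseteq> (\<lambda>w. l ^ k *\<^sub>R w) ` support P (super m ?T)"
          using U0(2)[OF q(1)] by blast
        also have "\<dots> = support P (super (k + m) ?T)"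
          by (simp add: support_supertile_of image_image power_add)
        finally show ?thesis .
      qed
      with S U0 show "S \<in> inner_tiles R (k + m) ?T" by (auto simp: inner_tiles_def supertile_of_add)
    qed
    then have "boundary_tiles R (k + m) ?T \<inter> boundary_tiles R k U0 = {}"
      by (auto simp: boundary_tiles_def)
    then have sub: "boundary_tiles R (k + m) ?T \<subseteq> (\<Union>U\<in>super m ?T - {U0}. boundary_tiles R k U)"
      using boundary_tiles_subset[of R k m ?T] by blast
    have "real (card (boundary_tiles R (k + m) ?T)) \<le> real (card (\<Union>U\<in>super m ?T - {U0}. boundary_tiles R k U))"
      using sub finite_supertile_of by (auto intro!: card_mono)
    also have "\<dots> \<le> (\<Sum>U\<in>super m ?T - {U0}. real (card (boundary_tiles R k U)))"
      using card_UN_le[of "super m ?T - {U0}" "\<lambda>U. boundary_tiles R k U"] finite_supertile_of[of m ?T]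
      by (simp flip: of_nat_sum)
    also have "\<dots> \<le> (\<Sum>U\<in>super m ?T - {U0}. B * (l ^ k)\<^sup>2 * area (proto U))"
    proof (rule sum_mono)
      fix U assume "U \<in> super m ?T - {U0}"
      then have "real (card (boundary_tiles R k U)) = f k (proto U) * ((l ^ k)\<^sup>2 * area (proto U))"
        using card_boundary_tiles[OF tile, of U] area_pos[of "proto U"] by (simp add: f_def)
      also have "\<dots> \<le> B * ((l ^ k)\<^sup>2 * area (proto U))"
        using B area_pos[of "proto U"] by (intro mult_right_mono) (auto simp: less_imp_le)
      finally show "real (card (boundary_tiles R k U)) \<le> B * (l ^ k)\<^sup>2 * area (proto U)" by simp
    qed
    also have "\<dots> = B * (l ^ k)\<^sup>2 * ((\<Sum>U\<in>super m ?T. area (proto U)) - area (proto U0))"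
      using U0 finite_supertile_of[of m ?T] by (simp add: sum_distrib_left[symmetric] sum_diff1)
    also have "\<dots> \<le> B * (l ^ k)\<^sup>2 * ((l ^ m)\<^sup>2 * area i - min_area)"
      using sum_area_supertile_of[OF is_tile_Tile[of i], of m] min_area_le[of "proto U0"] B
      by (intro mult_left_mono) auto
    also have "\<dots> \<le> B * (l ^ k)\<^sup>2 * (c * ((l ^ m)\<^sup>2 * area i))"
    proof -
      have "(1 - c) * ((l ^ m)\<^sup>2 * area i) = min_area * (area i / max_area)"
        by (simp add: c_def)
      also have "\<dots> \<le> min_area * 1"
        using le_max_area[of i] by (intro mult_left_mono) (auto simp: less_imp_le)
      finally have "(l ^ m)\<^sup>2 * area i - min_area \<le> c * ((l ^ m)\<^sup>2 * area i)"
        by (simp add: algebra_simps)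
      then show ?thesis using B by (intro mult_left_mono) auto
    qed
    also have "\<dots> = c * B * ((l ^ (k + m))\<^sup>2 * area i)"
      by (simp add: power_add power_mult_distrib)
    finally show "f (k + m) i \<le> c * B"
      using area_pos[of i] by (simp add: f_def divide_le_eq)
  qed
  then show ?thesis
  proof eventually_elim
    case (elim k)
    show ?case
    proof
      fix i
      have "real (card (boundary_tiles R k (Tile i 1 0))) < e / max_area * ((l ^ k)\<^sup>2 * area i)"
        using elim[rule_format, of i] area_pos[of i] by (simp add: f_def divide_less_eq)
      also have "\<dots> = e * (l ^ k)\<^sup>2 * (area i / max_area)" by simp
      also have "\<dots> \<le> e * (l ^ k)\<^sup>2 * 1"
        using le_max_area[of i] assms by (intro mult_left_mono) auto
      finally show "real (card (boundary_tiles R k (Tile i 1 0))) < e * (l ^ k)\<^sup>2" by simp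
    qed
  qed
qed

subsection \<open>Weyl sums of the orientations\<close>

text \<open>For \<open>T = Tile i 1 0\<close> this is the entry (j, i) of the k-th power of the
  matrix M(q).\<close>

definition weyl :: "nat \<Rightarrow> nat \<Rightarrow> 'n \<Rightarrow> 'n tile \<Rightarrow> complex" where
  "weyl q k j T = (\<Sum>S | S \<in> super k T \<and> proto S = j. rotor S ^ q)"

lemma finite_supertile_of_proto [simp]: "finite {S. S \<in> super k T \<and> proto S = j}"
  using finite_supertile_of by auto

lemma weyl_0: "weyl 0 k j T = of_nat (card {S \<in> super k T. proto S = j})"
  by (simp add: weyl_def)

lemma weyl_tile:
  assumes "is_tile T"
  shows "weyl q k j T = rotor T ^ q * weyl q k j (Tile (proto T) 1 0)"
proof -
  let ?m = "move_tile (rotor T) (l ^ k *\<^sub>R shift T)"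
  have "{S. S \<in> super k T \<and> proto S = j} = ?m ` {S. S \<in> super k (Tile (proto T) 1 0) \<and> proto S = j}"
    using supertile_of_eq_supertile[of l \<sigma> k T] by (auto simp: supertile_eq_supertile_of)
  then have "weyl q k j T = (\<Sum>S | S \<in> super k (Tile (proto T) 1 0) \<and> proto S = j. (rotor T * rotor S) ^ q)"
    unfolding weyl_def
    by (simp add: sum.reindex inj_on_subset[OF inj_move_tile[OF is_tile_nonzero[OF assms]]])
  then show ?thesis
    by (simp add: weyl_def power_mult_distrib sum_distrib_left)
qed

text \<open>Matrix multiplication of powers of M(q): rotors multiply along nested supertiles, and so
  do their q-th powers.\<close>

lemma weyl_add:
  assumes "is_tile T"
  shows "weyl q (k + m) j T = (\<Sum>i\<in>UNIV. weyl q k j (Tile i 1 0) * weyl q m i T)"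
proof -
  have "{S. S \<in> super (k + m) T \<and> proto S = j} = (\<Union>U\<in>super m T. {S. S \<in> super k U \<and> proto S = j})"
    by (auto simp: supertile_of_add)
  then have "weyl q (k + m) j T = (\<Sum>U\<in>super m T. weyl q k j U)"
    unfolding weyl_def using finite_supertile_of supertile_of_disjoint_nested[OF assms]
    by (subst sum.UNION_disjoint[symmetric]) auto
  also have "\<dots> = (\<Sum>i\<in>UNIV. \<Sum>U | U \<in> super m T \<and> proto U = i. weyl q k j U)"
    using sum.group[of "super m T" UNIV proto "weyl q k j"] finite_supertile_of by simp
  also have "\<dots> = (\<Sum>i\<in>UNIV. \<Sum>U | U \<in> super m T \<and> proto U = i. weyl q k j (Tile i 1 0) * rotor U ^ q)"
  proof (intro sum.cong refl)
    fix i U assume U: "U \<in> {U. U \<in> super m T \<and> proto U = i}"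
    then have "is_tile U" using is_tile_supertile_of[OF assms] by blast
    with U show "weyl q k j U = weyl q k j (Tile i 1 0) * rotor U ^ q"
      by (subst weyl_tile) (auto simp: mult.commute)
  qed
  finally show ?thesis
    by (simp add: weyl_def[of q m] sum_distrib_left)
qed

text \<open>The case \<open>q = 0\<close> of \<open>weyl\<close>, kept real so that it can dominate
  the other exponents.\<close>

definition type_count :: "nat \<Rightarrow> 'n \<Rightarrow> 'n tile \<Rightarrow> real" where
  "type_count k j T = real (card {S \<in> super k T. proto S = j})"

lemma type_count_add:
  assumes "is_tile T"
  shows "type_count (k + m) j T = (\<Sum>i\<in>UNIV. type_count k j (Tile i 1 0) * type_count m i T)"
proof -
  have "complex_of_real (type_count (k + m) j T)
      = complex_of_real (\<Sum>i\<in>UNIV. type_count k j (Tile i 1 0) * type_count m i T)"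
    using weyl_add[OF assms, of 0 k m j] by (simp add: weyl_0 type_count_def)
  then show ?thesis by (simp only: of_real_eq_iff)
qed

lemma type_count_tile:
  assumes "is_tile T"
  shows "type_count k j T = type_count k j (Tile (proto T) 1 0)"
proof -
  have "complex_of_real (type_count k j T) = complex_of_real (type_count k j (Tile (proto T) 1 0))"
    using weyl_tile[OF assms, of 0 k j] unfolding weyl_0 type_count_def
    by (simp only: power_0 mult_1 of_real_of_nat_eq)
  then show ?thesis by (simp only: of_real_eq_iff)
qed

lemma type_count_nonneg [simp]: "0 \<le> type_count k j T"
  by (simp add: type_count_def)

lemma norm_weyl_le: "is_tile T \<Longrightarrow> norm (weyl q k j T) \<le> type_count k j T"
  unfolding weyl_def type_count_def using is_tile_supertile_of[of T]
  by (intro order_trans[OF sum_norm_le[where g = "\<lambda>_. 1"]])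
     (auto simp: is_tile_def norm_power)

text \<open>The subeigenvector property of the areas, obtained by grouping the tiles of a supertile
  by type.\<close>

lemma weighted_type_count_le:
  assumes "is_tile T"
  shows "(\<Sum>i\<in>UNIV. area i * type_count k i T) \<le> (l ^ k)\<^sup>2 * area (proto T)"
proof -
  have "(\<Sum>U\<in>super k T. area (proto U)) = (\<Sum>i\<in>UNIV. \<Sum>U | U \<in> super k T \<and> proto U = i. area (proto U))"
    using sum.group[of "super k T" UNIV proto "\<lambda>U. area (proto U)"] finite_supertile_of by simp
  also have "\<dots> = (\<Sum>i\<in>UNIV. area i * type_count k i T)"
    by (intro sum.cong) (auto simp: type_count_def)
  finally show ?thesis using sum_area_supertile_of[OF assms, of k] by simp
qed

lemma matrix_power_type_count:
  "real (matrix_power (substitution_matrix \<sigma>) k $ i $ j) = type_count k i (Tile j 1 0)"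
proof (induction k arbitrary: i)
  case 0
  have "{S \<in> super 0 (Tile j 1 0). proto S = i} = (if i = j then {Tile j 1 0} else {})"
    by auto
  then show ?case
    by (simp add: matrix_power_def mat_def type_count_def)
next
  case (Suc k)
  have 1: "type_count 1 i (Tile m 1 0) = real (substitution_matrix \<sigma> $ i $ m)" for m
  proof -
    have "super 1 (Tile m 1 0) = \<sigma> m"
      unfolding supertile_of_1 by (simp add: subst_tile_def)
    then show ?thesis by (simp only: type_count_def substitution_matrix_def vec_lambda_beta)
  qed
  have "type_count (1 + k) i (Tile j 1 0) = (\<Sum>m\<in>UNIV. type_count 1 i (Tile m 1 0) * type_count k m (Tile j 1 0))"
    by (rule type_count_add) simp
  also have "\<dots> = real (matrix_power (substitution_matrix \<sigma>) (Suc k) $ i $ j)"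
    by (simp add: matrix_power_def matrix_matrix_mult_def 1 del: One_nat_def flip: Suc.IH)
  finally show ?case by simp
qed

lemma primitive_type_count:
  assumes "primitive_substitution \<sigma>"
  obtains p where "\<And>i j. 0 < type_count p i (Tile j 1 0)"
  using assms unfolding primitive_substitution_def
  by (metis matrix_power_type_count of_nat_0_less_iff)

text \<open>A single cancellation propagates to all entries by primitivity, and from there to an
  exponential gain by iteration.\<close>

lemma eventually_weyl_small:
  assumes prim: "primitive_substitution \<sigma>"
    and canc: "S \<in> super k0 T" "S' \<in> super k0 T" "is_tile T" "proto S = proto S'"
      "rotor S ^ q \<noteq> rotor S' ^ q"
    and "0 < e"
  shows "\<forall>\<^sub>F k in sequentially. \<forall>j. norm (weyl q k i (Tile j 1 0)) < e * (l ^ k)\<^sup>2"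
proof -
  obtain p where p: "\<And>i j. 0 < type_count p i (Tile j 1 0)"
    using primitive_type_count[OF prim] by blast
  let ?T = "\<lambda>i. Tile i 1 0 :: 'n tile"
  define a b where "a = proto S" and "b = proto T"
  have strict0: "norm (weyl q k0 a (?T b)) < type_count k0 a (?T b)"
  proof -
    have "norm (weyl q k0 a T) < type_count k0 a T"
      unfolding weyl_def type_count_def using canc is_tile_supertile_of[OF canc(3)]
      by (intro norm_sum_less_card[where v = S and w = S'])
         (auto simp: a_def is_tile_def norm_power)
    moreover have "weyl q k0 a T = rotor T ^ q * weyl q k0 a (?T b)"
      unfolding b_def by (rule weyl_tile[OF canc(3)])
    moreover have "type_count k0 a T = type_count k0 a (?T b)"
      unfolding b_def by (rule type_count_tile[OF canc(3)])
    ultimately show ?thesis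
      using canc(3) by (simp add: norm_mult norm_power is_tile_def)
  qed
  \<comment> \<open>By primitivity every order p supertile contains a tile of type b, so the strict
    summand \<open>i = b\<close> occurs for every starting type c.\<close>
  have strict1: "norm (weyl q (k0 + p) a (?T c)) < type_count (k0 + p) a (?T c)" for c
  proof -
    have "norm (weyl q (k0 + p) a (?T c))
        \<le> (\<Sum>i\<in>UNIV. norm (weyl q k0 a (?T i)) * norm (weyl q p i (?T c)))"
      by (simp add: weyl_add norm_mult sum_norm_le)
    also have "\<dots> < (\<Sum>i\<in>UNIV. type_count k0 a (?T i) * type_count p i (?T c))"
    proof (rule sum_strict_mono_ex1)
      show "\<forall>i\<in>UNIV. norm (weyl q k0 a (?T i)) * norm (weyl q p i (?T c))
          \<le> type_count k0 a (?T i) * type_count p i (?T c)"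
        by (auto intro!: mult_mono norm_weyl_le)
      have "norm (weyl q k0 a (?T b)) * norm (weyl q p b (?T c))
          \<le> norm (weyl q k0 a (?T b)) * type_count p b (?T c)"
        by (auto intro!: mult_mono norm_weyl_le)
      also have "\<dots> < type_count k0 a (?T b) * type_count p b (?T c)"
        using strict0 p by (intro mult_strict_right_mono)
      finally show "\<exists>i\<in>UNIV. norm (weyl q k0 a (?T i)) * norm (weyl q p i (?T c))
          < type_count k0 a (?T i) * type_count p i (?T c)" by blast
    qed simp
    finally show ?thesis by (simp add: type_count_add)
  qed
  \<comment> \<open>The p further levels produce tiles of every type d from those of type a, which
    spreads the strictness from the row a to all rows.\<close>
  define m where "m = p + (k0 + p)"
  have strict: "norm (weyl q m d (?T c)) < type_count m d (?T c)" for c d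
  proof -
    have "norm (weyl q m d (?T c))
        \<le> (\<Sum>i\<in>UNIV. norm (weyl q p d (?T i)) * norm (weyl q (k0 + p) i (?T c)))"
      unfolding m_def by (subst weyl_add) (simp_all add: norm_mult sum_norm_le)
    also have "\<dots> < (\<Sum>i\<in>UNIV. type_count p d (?T i) * type_count (k0 + p) i (?T c))"
    proof (rule sum_strict_mono_ex1)
      show "\<forall>i\<in>UNIV. norm (weyl q p d (?T i)) * norm (weyl q (k0 + p) i (?T c))
          \<le> type_count p d (?T i) * type_count (k0 + p) i (?T c)"
        by (auto intro!: mult_mono norm_weyl_le)
      have "norm (weyl q p d (?T a)) * norm (weyl q (k0 + p) a (?T c))
          \<le> type_count p d (?T a) * norm (weyl q (k0 + p) a (?T c))"
        by (auto intro!: mult_mono norm_weyl_le)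
      also have "\<dots> < type_count p d (?T a) * type_count (k0 + p) a (?T c)"
        using strict1 p by (intro mult_strict_left_mono)
      finally show "\<exists>i\<in>UNIV. norm (weyl q p d (?T i)) * norm (weyl q (k0 + p) i (?T c))
          < type_count p d (?T i) * type_count (k0 + p) i (?T c)" by blast
    qed simp
    finally show ?thesis unfolding m_def by (subst type_count_add) simp_all
  qed
  \<comment> \<open>There are finitely many entries, each strictly below its count, so the worst
    ratio is still below 1.\<close>
  define c where "c = Max (range (\<lambda>(d, c). norm (weyl q m d (?T c)) / type_count m d (?T c)))"
  have cpos: "0 < type_count m d (?T c)" for c d
    using strict[of d c] norm_ge_zero[of "weyl q m d (?T c)"] by linarith
  have c: "c < 1"
    unfolding c_def using strict cpos by (subst Max_less_iff) auto
  have le_c: "norm (weyl q m d (?T b)) \<le> c * type_count m d (?T b)" for d b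
  proof -
    have "norm (weyl q m d (?T b)) / type_count m d (?T b) \<le> c"
      unfolding c_def by (rule Max_ge) (auto intro!: image_eqI[where x = "(d, b)"])
    then show ?thesis using cpos[of d b] by (simp add: divide_le_eq)
  qed
  \<comment> \<open>Any one entry shows that the maximum is nonnegative; \<open>undefined\<close>
    just names an index.\<close>
  have "0 \<le> norm (weyl q m undefined (?T undefined)) / type_count m undefined (?T undefined)"
    by simp
  also have "\<dots> \<le> c"
    unfolding c_def by (rule Max_ge) (auto intro!: image_eqI[where x = "(undefined, undefined)"])
  finally have c0: "0 \<le> c" .
  define f where "f = (\<lambda>k j. norm (weyl q k i (?T j)) / ((l ^ k)\<^sup>2 * area j))"
  have "\<forall>\<^sub>F k in sequentially. \<forall>j. f k j < e / max_area"
  proof (rule contraction_eventually_less[OF c0 c, where m = m and ?k0.0 = 0])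
    show "0 < e / max_area" "0 \<le> max_area / min_area / min_area" using assms by (simp_all add: less_imp_le)
    show "f k j \<le> max_area / min_area / min_area" for k j
    proof -
      have "card {S \<in> super k (?T j). proto S = i} \<le> card (super k (?T j))"
        by (intro card_mono finite_supertile_of) auto
      then have "norm (weyl q k i (?T j)) \<le> max_area / min_area * (l ^ k)\<^sup>2 * 1"
        using card_supertile_of[OF is_tile_Tile[of j], of k] norm_weyl_le[OF is_tile_Tile[of j], of q k i]
        by (simp add: type_count_def)
      also have "\<dots> \<le> max_area / min_area * (l ^ k)\<^sup>2 * (area j / min_area)"
        using min_area_le[of j] by (intro mult_left_mono) (auto simp: less_imp_le)
      also have "\<dots> = max_area / min_area / min_area * ((l ^ k)\<^sup>2 * area j)"
        by simp
      finally show ?thesis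
        using area_pos[of j] by (simp add: f_def divide_le_eq)
    qed
  next
    fix k B j assume B: "0 \<le> B" "\<And>j. f k j \<le> B"
    have fB: "norm (weyl q k i (?T j)) \<le> B * (l ^ k)\<^sup>2 * area j" for j
      using B(2)[of j] area_pos[of j] by (simp add: f_def divide_le_eq mult.assoc)
    have "norm (weyl q (k + m) i (?T j))
        \<le> (\<Sum>d\<in>UNIV. norm (weyl q k i (?T d)) * norm (weyl q m d (?T j)))"
      by (simp add: weyl_add norm_mult sum_norm_le)
    \<comment> \<open>The inductive bound supplies exactly the weights \<open>area d\<close> with
      which \<open>weighted_type_count_le\<close> controls the remaining counts.\<close>
    also have "\<dots> \<le> (\<Sum>d\<in>UNIV. (B * (l ^ k)\<^sup>2 * area d) * (c * type_count m d (?T j)))"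
      using B(1) area_pos by (intro sum_mono mult_mono fB le_c) (auto simp: less_imp_le)
    also have "\<dots> = c * B * (l ^ k)\<^sup>2 * (\<Sum>d\<in>UNIV. area d * type_count m d (?T j))"
      by (simp add: sum_distrib_left mult_ac)
    also have "\<dots> \<le> c * B * (l ^ k)\<^sup>2 * ((l ^ m)\<^sup>2 * area j)"
      using weighted_type_count_le[OF is_tile_Tile[of j], of m] c0 B by (intro mult_left_mono) auto
    finally show "f (k + m) j \<le> c * B"
      using area_pos[of j] by (simp add: f_def divide_le_eq power_add power_mult_distrib mult_ac)
  qed
  then show ?thesis
  proof eventually_elim
    case (elim k)
    show ?case
    proof
      fix j
      have "norm (weyl q k i (?T j)) < e / max_area * ((l ^ k)\<^sup>2 * area j)"
        using elim[rule_format, of j] area_pos[of j] by (simp add: f_def divide_less_eq)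
      also have "\<dots> = e * (l ^ k)\<^sup>2 * (area j / max_area)" by simp
      also have "\<dots> \<le> e * (l ^ k)\<^sup>2 * 1"
        using le_max_area[of j] assms by (intro mult_left_mono) auto
      finally show "norm (weyl q k i (?T j)) < e * (l ^ k)\<^sup>2" by simp
    qed
  qed
qed

end

subsection \<open>Trigonometric polynomials\<close>

text \<open>Nonnegative exponents suffice under the real part, since inverse powers are conjugates
  on the unit circle. The rule \<open>cong\<close> records that only values on the circle
  matter.\<close>

inductive trig_poly :: "(complex \<Rightarrow> real) \<Rightarrow> bool" where
  monom: "trig_poly (\<lambda>z. Re (c * z ^ q))"
| add: "trig_poly f \<Longrightarrow> trig_poly g \<Longrightarrow> trig_poly (\<lambda>z. f z + g z)"
| cong: "trig_poly f \<Longrightarrow> (\<And>z. norm z = 1 \<Longrightarrow> g z = f z) \<Longrightarrow> trig_poly g"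

lemma Re_mult_Re: "Re a * Re b = Re (a * b / 2) + Re (a * cnj b / 2)"
  by (simp add: field_simps)

lemma power_mult_cnj_power:
  fixes z :: complex
  assumes "norm z = 1" "s \<le> q"
  shows "z ^ q * cnj z ^ s = z ^ (q - s)"
proof -
  have "z * cnj z = 1"
    using assms(1) by (simp add: complex_norm_square[symmetric] del: of_real_power)
  have "z ^ q * cnj z ^ s = z ^ (q - s) * (z * cnj z) ^ s"
    using assms(2) by (simp add: power_mult_distrib flip: power_add mult.assoc)
  then show ?thesis by (simp add: \<open>z * cnj z = 1\<close>)
qed

text \<open>The product-to-sum formula. The exponents may be ordered by symmetry, so that their
  difference is a natural number.\<close>

lemma trig_poly_mult_monom: "trig_poly (\<lambda>z. Re (c * z ^ q) * Re (d * z ^ s))"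
proof (induction q s arbitrary: c d rule: linorder_wlog)
  case (le s q)
  show ?case
  proof (rule trig_poly.cong)
    show "trig_poly (\<lambda>z. Re (c * d / 2 * z ^ (s + q)) + Re (cnj c * d / 2 * z ^ (q - s)))"
      by (intro trig_poly.intros)
    fix z :: complex assume z: "norm z = 1"
    have "Re (c * z ^ s) * Re (d * z ^ q)
        = Re (c * d / 2 * z ^ (s + q)) + Re (d * cnj c / 2 * (z ^ q * cnj z ^ s))"
      unfolding mult.commute[of "Re (c * z ^ s)"]
      by (subst Re_mult_Re) (simp only: complex_cnj_mult complex_cnj_power power_add mult_ac times_divide_eq_left times_divide_eq_right)
    then show "Re (c * z ^ s) * Re (d * z ^ q)
        = Re (c * d / 2 * z ^ (s + q)) + Re (cnj c * d / 2 * z ^ (q - s))"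
      using power_mult_cnj_power[OF z le] by (simp only: mult.commute[of d])
  qed
next
  case (sym q s)
  have "(\<lambda>z. Re (c * z ^ q) * Re (d * z ^ s)) = (\<lambda>z. Re (d * z ^ s) * Re (c * z ^ q))"
    by (simp only: mult.commute)
  with sym[of d c] show ?case by simp
qed

lemma trig_poly_mult:
  assumes "trig_poly f" "trig_poly g"
  shows "trig_poly (\<lambda>z. f z * g z)"
  using assms(1)
proof induction
  case (monom c q)
  from assms(2) show ?case
  proof induction
    case (monom d s)
    show ?case by (rule trig_poly_mult_monom)
  next
    case (add f g)
    then show ?case by (simp add: distrib_left trig_poly.add)
  next
    case (cong f g)
    from cong(3) show ?case by (rule trig_poly.cong) (simp add: cong)
  qed
next
  case (add f1 f2)
  then show ?case by (simp add: distrib_right trig_poly.add)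
next
  case (cong f1 f2)
  from cong(3) show ?case by (rule trig_poly.cong) (simp add: cong)
qed

lemma real_polynomial_function_trig_poly:
  "real_polynomial_function p \<Longrightarrow> trig_poly p"
proof (induction rule: real_polynomial_function.induct)
  case (linear f)
  \<comment> \<open>A real-linear form on the plane is \<open>Re (c * z)\<close>, where c is the
    conjugate of \<open>Complex (f 1) (f \<i>)\<close>.\<close>
  have "f z = Re (Complex (f 1) (- f \<i>) * z ^ 1)" for z
  proof -
    interpret bounded_linear f by fact
    have "z = Re z *\<^sub>R 1 + Im z *\<^sub>R \<i>" by (simp add: complex_eq_iff)
    then have "f z = Re z * f 1 + Im z * f \<i>" by (metis add scaleR real_scaleR_def)
    then show ?thesis by simp
  qed
  then show ?case by (intro trig_poly.cong[OF trig_poly.monom[of "Complex (f 1) (- f \<i>)" 1]]) blast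
next
  case (const c)
  show ?case using trig_poly.monom[of "of_real c" 0] by simp
next
  case (add f g)
  then show ?case by (intro trig_poly.add)
next
  case (mult f g)
  then show ?case by (intro trig_poly_mult)
qed

lemma trig_poly_approx:
  fixes h :: "complex \<Rightarrow> real"
  assumes "continuous_on (sphere 0 1) h" "0 < e"
  obtains p where "trig_poly p" "\<And>z. norm z = 1 \<Longrightarrow> \<bar>h z - p z\<bar> < e"
  using Stone_Weierstrass_real_polynomial_function[OF compact_sphere assms]
    real_polynomial_function_trig_poly by (metis mem_sphere_0)

subsection \<open>Equidistribution of orientations\<close>

context substitution_system
begin

text \<open>The congruence is inverted: the patch stays in place and the supertile is moved onto it.
  The shift of the starting tile is divided by \<open>l ^ k\<close>, because k substitutions
  multiply it by that factor.\<close>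

lemma substitution_tiling_embed:
  assumes "substitution_tiling P l \<sigma> \<T>" "finite F" "F \<subseteq> \<T>"
  obtains k T where "is_tile T" "F \<subseteq> super k T"
proof -
  obtain i k u t where u: "norm u = 1" and sub: "move_tile u t ` F \<subseteq> supertile l \<sigma> k i"
    using assms unfolding substitution_tiling_def congruent_patches_def by metis
  have "u \<noteq> 0" using u by auto
  define s where "s = (- t / u) /\<^sub>R l ^ k"
  have "F = move_tile (1 / u) (- t / u) ` move_tile u t ` F"
    using \<open>u \<noteq> 0\<close> by (simp add: image_image)
  also have "\<dots> \<subseteq> move_tile (1 / u) (l ^ k *\<^sub>R s) ` super k (Tile i 1 0)"
    using sub by (auto simp: s_def supertile_eq_supertile_of)
  also have "\<dots> = super k (move_tile (1 / u) s (Tile i 1 0))"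
    by (simp add: supertile_of_move_tile)
  finally show thesis
    using that is_tile_move_tile[OF _ is_tile_Tile] u by (metis norm_divide norm_one div_by_1)
qed

end

text \<open>Finitely many orientations would miss a whole interval, whose frequency 0 contradicts
  its positive length.\<close>

lemma infinite_rotors:
  assumes "statistical_circular_symmetry l \<sigma> \<T>"
  shows "infinite (rotor ` \<T>)"
proof
  assume "finite (rotor ` \<T>)"
  then have fin: "finite (tile_orientation ` \<T>)"
    unfolding tile_orientation_def by (metis finite_imageI image_image)
  obtain \<tau> where \<tau>: "bij_betw \<tau> UNIV \<T>"
    and lim: "\<And>x y. 0 \<le> x \<Longrightarrow> x < y \<Longrightarrow> y < 2 * pi \<Longrightarrow>
      (\<lambda>n. (1 / real n) * (\<Sum>j<n. indicator {x..y} (tile_orientation (\<tau> j)))) \<longlonglongrightarrow> (y - x) / (2 * pi)"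
    using assms by (auto simp: statistical_circular_symmetry_def supertile_numbering_def)
  have "infinite ({0<..<2 * pi} - tile_orientation ` \<T>)"
    using fin infinite_Ioo[of 0 "2 * pi"] by (simp add: Diff_infinite_finite)
  then obtain z where z: "z \<in> {0<..<2 * pi} - tile_orientation ` \<T>"
    using infinite_imp_nonempty by blast
  have "open ({0<..<2 * pi} - tile_orientation ` \<T>)"
    using fin by (intro open_Diff finite_imp_closed) auto
  then obtain e where e: "0 < e" "cball z e \<subseteq> {0<..<2 * pi} - tile_orientation ` \<T>"
    using z open_contains_cball by blast
  have "z - e \<in> cball z e" "z + e \<in> cball z e" using e by (auto simp: dist_real_def)
  with e(2) have "z - e \<in> {0<..<2 * pi}" "z + e \<in> {0<..<2 * pi}" by blast+
  then have "0 < z - e" "z + e < 2 * pi" by simp_all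
  then have *: "(\<lambda>n. (1 / real n) * (\<Sum>j<n. indicator {z - e..z + e} (tile_orientation (\<tau> j))))
      \<longlonglongrightarrow> (z + e - (z - e)) / (2 * pi)"
    using e by (intro lim) auto
  have "tile_orientation (\<tau> j) \<notin> {z - e..z + e}" for j
  proof -
    have "\<tau> j \<in> \<T>" using \<tau> by (auto simp: bij_betw_def)
    then have "tile_orientation (\<tau> j) \<notin> cball z e" using e by blast
    then show ?thesis by (auto simp: cball_eq_atLeastAtMost)
  qed
  then have "indicator {z - e..z + e} (tile_orientation (\<tau> j)) = (0::real)" for j
    by simp
  then have "(z + e - (z - e)) / (2 * pi) = 0"
    using * by (simp only: sum.neutral_const mult_zero_right LIMSEQ_const_iff)
  with e show False by simp
qed

context substitution_system
begin

text \<open>Any two tiles of the tiling lie in a common supertile. Without cancellation the q-th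
  power of the rotor would therefore be a function of the type on the whole tiling, and the rotors
  would be q-th roots of finitely many numbers.\<close>

lemma exists_cancellation:
  assumes "substitution_tiling P l \<sigma> \<T>" "statistical_circular_symmetry l \<sigma> \<T>" "0 < q"
  shows "\<exists>k T S S'. is_tile T \<and> S \<in> super k T \<and> S' \<in> super k T \<and> proto S = proto S' \<and>
    rotor S ^ q \<noteq> rotor S' ^ q"
proof (rule ccontr)
  assume no: "\<not> ?thesis"
  have eq: "rotor S ^ q = rotor S' ^ q" if S: "S \<in> \<T>" "S' \<in> \<T>" "proto S = proto S'" for S S'
  proof -
    obtain k T where "is_tile T" "{S, S'} \<subseteq> super k T"
      by (rule substitution_tiling_embed[OF assms(1), of "{S, S'}"]) (use S in auto)
    with no S show ?thesis by blast
  qed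
  have "finite (rotor ` {S \<in> \<T>. proto S = j})" for j
  proof (cases "\<exists>S\<in>\<T>. proto S = j")
    case True
    then obtain S where "S \<in> \<T>" "proto S = j" by blast
    then have "rotor S' ^ q = rotor S ^ q" if "S' \<in> \<T>" "proto S' = j" for S'
      using eq[OF that(1), of S] that(2) by (simp only:)
    then have "rotor ` {S \<in> \<T>. proto S = j} \<subseteq> {z. z ^ q = rotor S ^ q}"
      by (intro image_subsetI CollectI) (simp only: mem_Collect_eq)
    then show ?thesis
      by (rule finite_subset) (rule finite_nth_roots[OF assms(3)])
  next
    case False
    then have "{S \<in> \<T>. proto S = j} = {}" by blast
    then show ?thesis by (simp only: image_empty finite.emptyI)
  qed
  then have "finite (\<Union>j. rotor ` {S \<in> \<T>. proto S = j})"
    by (intro finite_UN_I finite_class.finite_UNIV)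
  moreover have "(\<Union>j. rotor ` {S \<in> \<T>. proto S = j}) = rotor ` \<T>" by blast
  ultimately show False using infinite_rotors[OF assms(2)] by simp
qed

end

locale equidistributed_substitution = substitution_system P l \<sigma> x
  for P :: "'n::finite \<Rightarrow> complex set" and l \<sigma> x +
  assumes weyl_small: "0 < q \<Longrightarrow> 0 < e \<Longrightarrow>
    \<forall>\<^sub>F k in sequentially. \<forall>j. norm (weyl q k i (Tile j 1 0)) < e * (l ^ k)\<^sup>2"
begin

text \<open>On a monomial, rotation by \<theta> produces the factor \<open>\<theta> ^ q - 1\<close>,
  which vanishes for \<open>q = 0\<close>; otherwise the Weyl sum decays. Uniformity in v is needed
  because supertiles occur in all rotated positions.\<close>

lemma trig_poly_equidistributed:
  assumes "trig_poly p" "norm \<theta> = 1" "0 < e"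
  shows "\<forall>\<^sub>F k in sequentially. \<forall>j v. norm v = 1 \<longrightarrow>
    \<bar>\<Sum>U | U \<in> super k (Tile j 1 0) \<and> proto U = i. p (v * \<theta> * rotor U) - p (v * rotor U)\<bar> < e * (l ^ k)\<^sup>2"
  using assms(1,3)
proof (induction arbitrary: e)
  case (monom c q)
  show ?case
  proof (cases "q = 0")
    case True
    then show ?thesis using monom by simp
  next
    case False
    \<comment> \<open>The factor 2 bounds \<open>\<theta> ^ q - 1\<close>; the summand 1 keeps the
      denominator positive when \<open>c = 0\<close>.\<close>
    have "0 < e / (2 * norm c + 1)" using monom by (simp add: add_nonneg_pos)
    from weyl_small[OF _ this, of q i] False
    have "\<forall>\<^sub>F k in sequentially. \<forall>j. norm (weyl q k i (Tile j 1 0)) < e / (2 * norm c + 1) * (l ^ k)\<^sup>2"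
      by simp
    then show ?thesis
    proof eventually_elim
      case (elim k)
      show ?case
      proof (intro allI impI)
        fix j and v :: complex assume v: "norm v = 1"
        let ?A = "{U. U \<in> super k (Tile j 1 0) \<and> proto U = i}"
        have "(\<Sum>U\<in>?A. Re (c * (v * \<theta> * rotor U) ^ q) - Re (c * (v * rotor U) ^ q))
            = Re (c * v ^ q * (\<theta> ^ q - 1) * weyl q k i (Tile j 1 0))"
          by (simp only: weyl_def sum_distrib_left Re_sum minus_complex.sel(1)[symmetric])
             (intro sum.cong refl arg_cong[where f = Re], simp add: algebra_simps power_mult_distrib)
        also have "\<bar>\<dots>\<bar> \<le> norm (c * v ^ q * (\<theta> ^ q - 1) * weyl q k i (Tile j 1 0))"
          by (rule abs_Re_le_cmod)
        also have "\<dots> = norm c * norm (\<theta> ^ q - 1) * norm (weyl q k i (Tile j 1 0))"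
          using v by (simp add: norm_mult norm_power)
        also have "\<dots> \<le> norm c * 2 * norm (weyl q k i (Tile j 1 0))"
          using norm_triangle_ineq4[of "\<theta> ^ q" 1] assms(2)
          by (intro mult_right_mono mult_left_mono) (auto simp: norm_power)
        also have "\<dots> \<le> (2 * norm c + 1) * norm (weyl q k i (Tile j 1 0))"
          by (simp add: algebra_simps)
        also have "\<dots> < (2 * norm c + 1) * (e / (2 * norm c + 1) * (l ^ k)\<^sup>2)"
          using elim by (intro mult_strict_left_mono) (auto simp: add_nonneg_pos)
        also have "\<dots> = e * (l ^ k)\<^sup>2"
          using norm_ge_zero[of c] by (simp add: field_simps add_nonneg_eq_0_iff)
        finally show "\<bar>\<Sum>U\<in>?A. Re (c * (v * \<theta> * rotor U) ^ q) - Re (c * (v * rotor U) ^ q)\<bar>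
            < e * (l ^ k)\<^sup>2" .
      qed
    qed
  qed
next
  case (add f g)
  from add.prems have "0 < e / 2" by simp
  from add.IH(1)[OF this] add.IH(2)[OF this] show ?case
  proof eventually_elim
    case (elim k)
    show ?case
    proof (intro allI impI)
      fix j and v :: complex assume v: "norm v = 1"
      let ?A = "{U. U \<in> super k (Tile j 1 0) \<and> proto U = i}"
      have "(\<Sum>U\<in>?A. f (v * \<theta> * rotor U) + g (v * \<theta> * rotor U) - (f (v * rotor U) + g (v * rotor U)))
          = (\<Sum>U\<in>?A. f (v * \<theta> * rotor U) - f (v * rotor U))
          + (\<Sum>U\<in>?A. g (v * \<theta> * rotor U) - g (v * rotor U))"
        by (simp add: sum.distrib[symmetric] algebra_simps)
      moreover have "\<bar>\<Sum>U\<in>?A. f (v * \<theta> * rotor U) - f (v * rotor U)\<bar> < e / 2 * (l ^ k)\<^sup>2"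
        "\<bar>\<Sum>U\<in>?A. g (v * \<theta> * rotor U) - g (v * rotor U)\<bar> < e / 2 * (l ^ k)\<^sup>2"
        using elim v by blast+
      ultimately show "\<bar>\<Sum>U\<in>?A. f (v * \<theta> * rotor U) + g (v * \<theta> * rotor U) - (f (v * rotor U) + g (v * rotor U))\<bar>
          < e * (l ^ k)\<^sup>2"
        using field_sum_of_halves[of "e * (l ^ k)\<^sup>2"] unfolding times_divide_eq_left by linarith
    qed
  qed
next
  case (cong f g)
  from cong.IH[OF cong.prems] show ?case
  proof eventually_elim
    case (elim k)
    show ?case
    proof (intro allI impI)
      fix j and v :: complex assume v: "norm v = 1"
      let ?A = "{U. U \<in> super k (Tile j 1 0) \<and> proto U = i}"
      have "(\<Sum>U\<in>?A. g (v * \<theta> * rotor U) - g (v * rotor U))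
          = (\<Sum>U\<in>?A. f (v * \<theta> * rotor U) - f (v * rotor U))"
      proof (rule sum.cong[OF refl])
        fix U assume "U \<in> ?A"
        then have "norm (rotor U) = 1"
          using is_tile_supertile_of[OF is_tile_Tile] by (auto simp: is_tile_def)
        then show "g (v * \<theta> * rotor U) - g (v * rotor U) = f (v * \<theta> * rotor U) - f (v * rotor U)"
          using v assms(2) by (simp add: cong.hyps norm_mult)
      qed
      then show "\<bar>\<Sum>U\<in>?A. g (v * \<theta> * rotor U) - g (v * rotor U)\<bar> < e * (l ^ k)\<^sup>2"
        using elim v by simp
    qed
  qed
qed

lemma continuous_equidistributed_proto:
  assumes h: "continuous_on (sphere 0 1) h" and \<theta>: "norm \<theta> = 1" and e: "0 < e"
  shows "\<forall>\<^sub>F k in sequentially. \<forall>j v. norm v = 1 \<longrightarrow>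
    \<bar>\<Sum>U | U \<in> super k (Tile j 1 0) \<and> proto U = i. h (v * \<theta> * rotor U) - h (v * rotor U)\<bar> < e * (l ^ k)\<^sup>2"
proof -
  \<comment> \<open>Each tile costs at most two approximation errors, and there are at most
    \<open>max_area / min_area * (l ^ k)\<^sup>2\<close> tiles, so the total error is half of the
    allowance.\<close>
  define e1 where "e1 = e * min_area / (4 * max_area)"
  have "0 < e1" using e by (simp add: e1_def)
  then obtain p where p: "trig_poly p" "\<And>z. norm z = 1 \<Longrightarrow> \<bar>h z - p z\<bar> < e1"
    using trig_poly_approx[OF h] by blast
  have "0 < e / 2" using e by simp
  from trig_poly_equidistributed[OF p(1) \<theta> this, of i] show ?thesis
  proof eventually_elim
    case (elim k)
    show ?case
    proof (intro allI impI)
      fix j and v :: complex assume v: "norm v = 1"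
      let ?A = "{U. U \<in> super k (Tile j 1 0) \<and> proto U = i}"
      have r: "norm (rotor U) = 1" if "U \<in> ?A" for U
        using that is_tile_supertile_of[OF is_tile_Tile] by (auto simp: is_tile_def)
      have "\<bar>(\<Sum>U\<in>?A. h (v * \<theta> * rotor U) - h (v * rotor U)) - (\<Sum>U\<in>?A. p (v * \<theta> * rotor U) - p (v * rotor U))\<bar>
          \<le> (\<Sum>U\<in>?A. \<bar>h (v * \<theta> * rotor U) - h (v * rotor U) - (p (v * \<theta> * rotor U) - p (v * rotor U))\<bar>)"
        by (simp only: sum_subtractf[symmetric] sum_abs)
      also have "\<dots> \<le> (\<Sum>U\<in>?A. 2 * e1)"
      proof (rule sum_mono)
        fix U assume "U \<in> ?A"
        with r v \<theta> have "norm (v * \<theta> * rotor U) = 1" "norm (v * rotor U) = 1"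
          by (simp_all add: norm_mult)
        from this[THEN p(2)] show "\<bar>h (v * \<theta> * rotor U) - h (v * rotor U) - (p (v * \<theta> * rotor U) - p (v * rotor U))\<bar> \<le> 2 * e1"
          by linarith
      qed
      also have "\<dots> \<le> real (card (super k (Tile j 1 0))) * (2 * e1)"
        using \<open>0 < e1\<close> finite_supertile_of by (auto intro!: mult_right_mono card_mono)
      also have "\<dots> \<le> max_area / min_area * (l ^ k)\<^sup>2 * (2 * e1)"
        using card_supertile_of[OF is_tile_Tile[of j], of k] \<open>0 < e1\<close> by (intro mult_right_mono) auto
      also have "\<dots> = e / 2 * (l ^ k)\<^sup>2"
        using max_area_pos by (simp add: e1_def del: max_area_pos)
      finally show "\<bar>\<Sum>U\<in>?A. h (v * \<theta> * rotor U) - h (v * rotor U)\<bar> < e * (l ^ k)\<^sup>2"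
        using elim[rule_format, OF v, of j] field_sum_of_halves[of "e * (l ^ k)\<^sup>2"]
        unfolding times_divide_eq_left by linarith
    qed
  qed
qed

text \<open>The function may depend on the type of the tile because the Weyl sums are small for each
  type separately; it will be the contribution of a supertile of that type.\<close>

lemma continuous_equidistributed:
  assumes h: "\<And>i. continuous_on (sphere 0 1) (h i)" and \<theta>: "norm \<theta> = 1" and e: "0 < e"
  shows "\<forall>\<^sub>F k in sequentially. \<forall>j v. norm v = 1 \<longrightarrow>
    \<bar>\<Sum>U\<in>super k (Tile j 1 0). h (proto U) (v * \<theta> * rotor U) - h (proto U) (v * rotor U)\<bar> \<le> e * (l ^ k)\<^sup>2"
proof -
  let ?e = "e / real CARD('n)"
  have "0 < ?e" using e by simp
  then have "\<forall>\<^sub>F k in sequentially. \<forall>i. \<forall>j v. norm v = 1 \<longrightarrow>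
    \<bar>\<Sum>U | U \<in> super k (Tile j 1 0) \<and> proto U = i. h i (v * \<theta> * rotor U) - h i (v * rotor U)\<bar> < ?e * (l ^ k)\<^sup>2"
    by (intro eventually_all_finite[OF continuous_equidistributed_proto[OF h \<theta>]])
  then show ?thesis
  proof eventually_elim
    case (elim k)
    show ?case
    proof (intro allI impI)
      fix j and v :: complex assume v: "norm v = 1"
      let ?A = "\<lambda>i. {U. U \<in> super k (Tile j 1 0) \<and> proto U = i}"
      have "(\<Sum>U\<in>super k (Tile j 1 0). h (proto U) (v * \<theta> * rotor U) - h (proto U) (v * rotor U))
          = (\<Sum>i\<in>UNIV. \<Sum>U\<in>?A i. h (proto U) (v * \<theta> * rotor U) - h (proto U) (v * rotor U))"
        using sum.group[of "super k (Tile j 1 0)" UNIV proto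
            "\<lambda>U. h (proto U) (v * \<theta> * rotor U) - h (proto U) (v * rotor U)"] finite_supertile_of by simp
      also have "\<dots> = (\<Sum>i\<in>UNIV. \<Sum>U\<in>?A i. h i (v * \<theta> * rotor U) - h i (v * rotor U))"
        by (intro sum.cong) auto
      also have "\<bar>\<dots>\<bar> \<le> (\<Sum>i\<in>(UNIV::'n set). ?e * (l ^ k)\<^sup>2)"
        by (rule order_trans[OF sum_abs], rule sum_mono) (use elim v in \<open>meson less_imp_le\<close>)
      also have "\<dots> = e * (l ^ k)\<^sup>2" by simp
      finally show "\<bar>\<Sum>U\<in>super k (Tile j 1 0). h (proto U) (v * \<theta> * rotor U) - h (proto U) (v * rotor U)\<bar>
          \<le> e * (l ^ k)\<^sup>2" .
    qed
  qed
qed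

end

subsection \<open>Pair sums\<close>

text \<open>A sum over points, not tiles: coinciding control points count once, as they do in the
  set \<Lambda>.\<close>

definition pair_sum :: "(complex \<Rightarrow> real) \<Rightarrow> complex set \<Rightarrow> real" where
  "pair_sum f L = (\<Sum>p\<in>L. \<Sum>y\<in>L. f (p - y))"

lemma pair_sum_motion:
  assumes "u \<noteq> 0"
  shows "pair_sum f ((\<lambda>z. u * z + t) ` L) = pair_sum (\<lambda>z. f (u * z)) L"
proof -
  have "inj_on (\<lambda>z. u * z + t) L" using assms by (auto simp: inj_on_def)
  then show ?thesis by (simp add: pair_sum_def sum.reindex algebra_simps)
qed

context substitution_system
begin

text \<open>The packing bound for the number of tiles with control point in a ball of radius R,
  hence for the nonzero terms in one row of a pair sum.\<close>

definition row_bound :: "real \<Rightarrow> real" where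
  "row_bound R = pi * (R + diam)\<^sup>2 / min_area"

lemma row_bound_nonneg [simp]: "0 \<le> row_bound R"
  unfolding row_bound_def by (intro divide_nonneg_pos) auto

lemma row_sum_le:
  assumes "finite X" "non_overlapping P X" "\<And>T. T \<in> X \<Longrightarrow> is_tile T"
    and f: "\<And>z. \<bar>f z\<bar> \<le> B" "\<And>z. f z \<noteq> 0 \<Longrightarrow> norm z < R" and "0 < R"
  shows "\<bar>\<Sum>y\<in>cp ` X. f (p - y)\<bar> \<le> row_bound R * B"
proof -
  let ?Y = "{T \<in> X. cp T \<in> cball p R}"
  have "0 \<le> B" using f(1)[of 0] by linarith
  have "(\<Sum>y\<in>cp ` X. f (p - y)) = (\<Sum>y\<in>cp ` ?Y. f (p - y))"
  proof (rule sum.mono_neutral_right)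
    show "\<forall>y\<in>cp ` X - cp ` ?Y. f (p - y) = 0"
      using f(2) by (force simp: dist_norm)
  qed (use assms(1) in auto)
  also have "\<bar>\<dots>\<bar> \<le> (\<Sum>y\<in>cp ` ?Y. B)"
    using f(1) by (intro order_trans[OF sum_abs] sum_mono)
  also have "\<dots> \<le> real (card ?Y) * B"
    using \<open>0 \<le> B\<close> assms(1) by (auto intro!: mult_right_mono card_image_le)
  also have "\<dots> \<le> row_bound R * B"
    unfolding row_bound_def using assms non_overlapping_subset[OF assms(2)] \<open>0 \<le> B\<close>
    by (intro mult_right_mono cp_packing(2)[where c = p]) auto
  finally show ?thesis .
qed

text \<open>Only rows are dropped; the inner sum keeps all of X, so each omitted tile costs at most
  one row.\<close>

lemma row_sums_diff_le:
  assumes "finite X" "non_overlapping P X" "\<And>T. T \<in> X \<Longrightarrow> is_tile T" "G \<subseteq> X"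
    and f: "\<And>z. \<bar>f z\<bar> \<le> B" "\<And>z. f z \<noteq> 0 \<Longrightarrow> norm z < R" and "0 < R"
  shows "\<bar>pair_sum f (cp ` X) - (\<Sum>p\<in>cp ` G. \<Sum>y\<in>cp ` X. f (p - y))\<bar>
    \<le> row_bound R * B * real (card (X - G))"
proof -
  let ?F = "\<lambda>p. \<Sum>y\<in>cp ` X. f (p - y)"
  have "0 \<le> B" using f(1)[of 0] by linarith
  have "pair_sum f (cp ` X) - (\<Sum>p\<in>cp ` G. ?F p) = (\<Sum>p\<in>cp ` X - cp ` G. ?F p)"
    unfolding pair_sum_def using assms by (subst sum_diff) auto
  also have "\<bar>\<dots>\<bar> \<le> (\<Sum>p\<in>cp ` X - cp ` G. row_bound R * B)"
    using assms by (intro order_trans[OF sum_abs] sum_mono row_sum_le) auto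
  also have "\<dots> = row_bound R * B * real (card (cp ` X - cp ` G))" by simp
  also have "\<dots> \<le> row_bound R * B * real (card (X - G))"
  proof -
    have "card (cp ` X - cp ` G) \<le> card (cp ` (X - G))"
      using assms by (intro card_mono) auto
    also have "\<dots> \<le> card (X - G)" using assms by (intro card_image_le) auto
    finally show ?thesis using \<open>0 \<le> B\<close> by (intro mult_left_mono) auto
  qed
  finally show ?thesis .
qed

text \<open>Different tiles may share a control point. This does no harm, because two inner tiles with
  the same control point always lie in the same supertile.\<close>

lemma pair_sum_decompose:
  assumes X: "finite X" "non_overlapping P X" "\<And>T. T \<in> X \<Longrightarrow> is_tile T"
    and I: "finite I" "\<And>U. U \<in> I \<Longrightarrow> is_tile U" "\<And>U. U \<in> I \<Longrightarrow> super n U \<subseteq> X"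
      "\<And>U V T. U \<in> I \<Longrightarrow> V \<in> I \<Longrightarrow> T \<in> super n U \<Longrightarrow> T \<in> super n V \<Longrightarrow> U = V"
    and f: "\<And>z. \<bar>f z\<bar> \<le> B" "\<And>z. f z \<noteq> 0 \<Longrightarrow> norm z < R" and "0 < R"
  shows "\<bar>pair_sum f (cp ` X) - (\<Sum>U\<in>I. pair_sum f (cp ` super n U))\<bar>
    \<le> 2 * row_bound R * B * real (card (X - (\<Union>U\<in>I. inner_tiles R n U)))"
proof -
  let ?G = "\<Union>U\<in>I. inner_tiles R n U"
  let ?C = "row_bound R * B"
  have "0 \<le> B" using f(1)[of 0] by linarith
  have inner_sub: "inner_tiles R n U \<subseteq> super n U" for U by (auto simp: inner_tiles_def)
  \<comment> \<open>The open ball of radius R about the control point of an inner tile is interior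
    to the support of its supertile, and a tile of X with a point there belongs to that
    supertile.\<close>
  have row_bound: "T' \<in> super n U" if "U \<in> I" "T \<in> inner_tiles R n U" "T' \<in> X" "norm (cp T - cp T') < R" for U T T'
  proof -
    have "cball (cp T) R \<subseteq> support P (super n U)"
      using that cp_in_tile by (auto simp: inner_tiles_def)
    then have "ball (cp T) R \<subseteq> interior (support P (super n U))"
      by (intro interior_maximal) auto
    then have "cp T' \<in> interior (support P (super n U))"
      using that by (auto simp: dist_norm)
    then show ?thesis
      using mem_of_interior_support[OF X(2) I(3) X(3)] that cp_in_tile by blast
  qed
  have row: "(\<Sum>y\<in>cp ` super n U. f (p - y)) = (\<Sum>y\<in>cp ` X. f (p - y))"
    if "U \<in> I" "p \<in> cp ` inner_tiles R n U" for U p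
  proof (rule sum.mono_neutral_left)
    show "\<forall>y\<in>cp ` X - cp ` super n U. f (p - y) = 0"
      using that row_bound f(2) by fast
    show "cp ` super n U \<subseteq> cp ` X" by (intro image_mono I(3) that(1))
  qed (use X in simp)
  have dis: "cp ` inner_tiles R n U \<inter> cp ` inner_tiles R n V = {}" if UV: "U \<in> I" "V \<in> I" "U \<noteq> V" for U V
  proof (rule ccontr)
    assume "\<not> ?thesis"
    then obtain T T' where T: "T \<in> inner_tiles R n U" "T' \<in> inner_tiles R n V" "cp T = cp T'" by auto
    then have "T' \<in> X" using I(3) inner_sub UV by blast
    then have "T' \<in> super n U" using row_bound[of U T T'] T UV \<open>0 < R\<close> by auto
    then show False using I(4) UV T inner_sub by blast
  qed
  have "(\<Sum>p\<in>cp ` ?G. \<Sum>y\<in>cp ` X. f (p - y))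
      = (\<Sum>U\<in>I. \<Sum>p\<in>cp ` inner_tiles R n U. \<Sum>y\<in>cp ` X. f (p - y))"
    unfolding image_UN
    using I(1) dis finite_subset[OF inner_sub finite_supertile_of] by (intro sum.UNION_disjoint) auto
  also have "\<dots> = (\<Sum>U\<in>I. \<Sum>p\<in>cp ` inner_tiles R n U. \<Sum>y\<in>cp ` super n U. f (p - y))"
    by (intro sum.cong[OF refl] row[symmetric])
  finally have eq: "(\<Sum>p\<in>cp ` ?G. \<Sum>y\<in>cp ` X. f (p - y))
      = (\<Sum>U\<in>I. \<Sum>p\<in>cp ` inner_tiles R n U. \<Sum>y\<in>cp ` super n U. f (p - y))" .
  \<comment> \<open>The whole pair sum and the split one are both compared with the sum over the
    rows of inner tiles; each comparison costs one row per remaining tile, hence the factor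
    2.\<close>
  have "\<bar>(\<Sum>U\<in>I. pair_sum f (cp ` super n U)) - (\<Sum>p\<in>cp ` ?G. \<Sum>y\<in>cp ` X. f (p - y))\<bar>
      \<le> (\<Sum>U\<in>I. \<bar>pair_sum f (cp ` super n U) - (\<Sum>p\<in>cp ` inner_tiles R n U. \<Sum>y\<in>cp ` super n U. f (p - y))\<bar>)"
    unfolding eq by (simp only: sum_subtractf[symmetric] sum_abs)
  also have "\<dots> \<le> (\<Sum>U\<in>I. ?C * real (card (super n U - inner_tiles R n U)))"
  proof (rule sum_mono)
    fix U assume "U \<in> I"
    then have U: "is_tile U" by (rule I(2))
    show "\<bar>pair_sum f (cp ` super n U) - (\<Sum>p\<in>cp ` inner_tiles R n U. \<Sum>y\<in>cp ` super n U. f (p - y))\<bar>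
        \<le> ?C * real (card (super n U - inner_tiles R n U))"
      by (rule row_sums_diff_le[OF finite_supertile_of non_overlapping_supertile_of[OF U] is_tile_supertile_of[OF U] inner_sub f \<open>0 < R\<close>])
  qed
  also have "\<dots> = ?C * real (\<Sum>U\<in>I. card (super n U - inner_tiles R n U))"
    by (simp add: sum_distrib_left)
  also have "(\<Sum>U\<in>I. card (super n U - inner_tiles R n U)) = card (\<Union>U\<in>I. super n U - inner_tiles R n U)"
    using I finite_supertile_of by (intro card_UN_disjoint[symmetric]) auto
  also have "?C * real \<dots> \<le> ?C * real (card (X - ?G))"
  proof -
    have "(\<Union>U\<in>I. super n U - inner_tiles R n U) \<subseteq> X - ?G"
    proof clarify
      fix T U assume T: "U \<in> I" "T \<in> super n U" "T \<notin> inner_tiles R n U"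
      moreover have "T \<notin> inner_tiles R n V" if "V \<in> I" for V
        using T that inner_sub[of V] I(4)[of U V T] by blast
      ultimately show "T \<in> X - ?G" using I(3) by blast
    qed
    then show ?thesis
      using X(1) \<open>0 \<le> B\<close> by (intro mult_left_mono of_nat_mono card_mono) auto
  qed
  finally have "\<bar>(\<Sum>U\<in>I. pair_sum f (cp ` super n U)) - (\<Sum>p\<in>cp ` ?G. \<Sum>y\<in>cp ` X. f (p - y))\<bar>
      \<le> ?C * real (card (X - ?G))" .
  moreover have "?G \<subseteq> X" using inner_sub I(3) by blast
  then have "\<bar>pair_sum f (cp ` X) - (\<Sum>p\<in>cp ` ?G. \<Sum>y\<in>cp ` X. f (p - y))\<bar>
      \<le> ?C * real (card (X - ?G))"
    by (intro row_sums_diff_le X f \<open>0 < R\<close>)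
  ultimately show ?thesis by linarith
qed

text \<open>The contribution of an order n supertile of type i as a function of its rotor u, with
  the rotation shifted to the test function. Allowing all complex u makes continuity
  immediate.\<close>

definition super_sum :: "(complex \<Rightarrow> real) \<Rightarrow> nat \<Rightarrow> 'n \<Rightarrow> complex \<Rightarrow> real" where
  "super_sum f n i u = pair_sum (\<lambda>z. f (u * z)) (cp ` super n (Tile i 1 0))"

lemma pair_sum_supertile_of:
  assumes "is_tile U"
  shows "pair_sum f (cp ` super n U) = super_sum f n (proto U) (rotor U)"
proof -
  have "cp ` super n U = (\<lambda>z. rotor U * z + l ^ n *\<^sub>R shift U) ` cp ` super n (Tile (proto U) 1 0)"
    unfolding supertile_of_eq_supertile[of l \<sigma> n U] supertile_eq_supertile_of
    by (simp add: image_image control_point_move)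
  then show ?thesis
    unfolding super_sum_def by (simp only: pair_sum_motion[OF is_tile_nonzero[OF assms]])
qed

lemma super_sum_rotate: "super_sum (\<lambda>z. f (v * z)) n i u = super_sum f n i (v * u)"
  by (simp add: super_sum_def mult.assoc)

lemma continuous_super_sum:
  assumes "continuous_on UNIV f"
  shows "continuous_on A (super_sum f n i)"
  unfolding super_sum_def pair_sum_def
  by (intro continuous_intros continuous_on_compose2[OF assms]) auto

text \<open>The surrounding patch is itself a supertile, turned by v; its piece grown from U then
  has rotor \<open>v * rotor U\<close>, which is where the contribution of the piece is
  evaluated.\<close>

lemma super_sum_decompose:
  assumes f: "\<And>z. \<bar>f z\<bar> \<le> B" "\<And>z. f z \<noteq> 0 \<Longrightarrow> norm z < R" and "0 < R" and v: "norm v = 1"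
  shows "\<bar>super_sum f (k + m) i v - (\<Sum>U\<in>super m (Tile i 1 0). super_sum f k (proto U) (v * rotor U))\<bar>
    \<le> 2 * row_bound R * B * (\<Sum>U\<in>super m (Tile i 1 0). real (card (boundary_tiles R k U)))"
proof -
  let ?T = "Tile i 1 0 :: 'n tile"
  let ?f = "\<lambda>z. f (v * z)"
  have "0 \<le> B" using f(1)[of 0] by linarith
  have tile: "U \<in> super m ?T \<Longrightarrow> is_tile U" for U by (rule is_tile_supertile_of[OF is_tile_Tile])
  have "\<bar>pair_sum ?f (cp ` super (k + m) ?T) - (\<Sum>U\<in>super m ?T. pair_sum ?f (cp ` super k U))\<bar>
      \<le> 2 * row_bound R * B * real (card (super (k + m) ?T - (\<Union>U\<in>super m ?T. inner_tiles R k U)))"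
  proof (rule pair_sum_decompose)
    show "norm z < R" if "?f z \<noteq> 0" for z
      using f(2)[OF that] v by (simp add: norm_mult)
    show "U = V" if "U \<in> super m ?T" "V \<in> super m ?T" "T \<in> super k U" "T \<in> super k V" for U V T
      by (rule supertile_of_disjoint_nested[OF is_tile_Tile that])
    show "non_overlapping P (super (k + m) ?T)" by (rule non_overlapping_supertile_of) simp
    show "is_tile S" if "S \<in> super (k + m) ?T" for S
      by (rule is_tile_supertile_of[OF is_tile_Tile that])
    show "super k U \<subseteq> super (k + m) ?T" if "U \<in> super m ?T" for U
      using that by (auto simp: supertile_of_add)
  qed (use f \<open>0 < R\<close> tile finite_supertile_of in auto)
  also have "\<dots> \<le> 2 * row_bound R * B * (\<Sum>U\<in>super m ?T. real (card (boundary_tiles R k U)))"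
  proof -
    have "super (k + m) ?T - (\<Union>U\<in>super m ?T. inner_tiles R k U) \<subseteq> (\<Union>U\<in>super m ?T. boundary_tiles R k U)"
      by (auto simp: supertile_of_add boundary_tiles_def)
    then have "card (super (k + m) ?T - (\<Union>U\<in>super m ?T. inner_tiles R k U)) \<le> card (\<Union>U\<in>super m ?T. boundary_tiles R k U)"
      using finite_supertile_of by (intro card_mono) auto
    also have "\<dots> \<le> (\<Sum>U\<in>super m ?T. card (boundary_tiles R k U))"
      using finite_supertile_of by (rule card_UN_le)
    finally have "real (card (super (k + m) ?T - (\<Union>U\<in>super m ?T. inner_tiles R k U)))
        \<le> (\<Sum>U\<in>super m ?T. real (card (boundary_tiles R k U)))"
      by (simp flip: of_nat_sum)
    then show ?thesis using \<open>0 \<le> B\<close> by (intro mult_left_mono) auto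
  qed
  also have "pair_sum ?f (cp ` super (k + m) ?T) = super_sum f (k + m) i v"
    by (simp add: super_sum_def)
  also have "(\<Sum>U\<in>super m ?T. pair_sum ?f (cp ` super k U))
      = (\<Sum>U\<in>super m ?T. super_sum f k (proto U) (v * rotor U))"
    using tile by (intro sum.cong refl) (simp add: pair_sum_supertile_of super_sum_rotate)
  finally show ?thesis .
qed

end

context equidistributed_substitution
begin

text \<open>Both bounds are needed at the same n, because a large ball is cut into supertiles of
  this one order.\<close>

lemma exists_symmetric_level:
  assumes cont: "continuous_on UNIV f"
    and f: "\<And>z. \<bar>f z\<bar> \<le> B" "\<And>z. f z \<noteq> 0 \<Longrightarrow> norm z < R" and "0 < R"
    and \<theta>: "norm \<theta> = 1" and e: "0 < e"
  obtains n where
    "\<And>i v. norm v = 1 \<Longrightarrow> \<bar>super_sum f n i (v * \<theta>) - super_sum f n i v\<bar> \<le> e * (l ^ n)\<^sup>2"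
    "\<And>i. real (card (boundary_tiles R n (Tile i 1 0))) \<le> e * (l ^ n)\<^sup>2"
proof -
  have "0 \<le> B" using f(1)[of 0] by linarith
  \<comment> \<open>The two decomposition errors, at v and at \<open>v * \<theta>\<close>, add up to
    at most \<open>(C - 1) * d * (l ^ (k + m))\<^sup>2\<close>, which is half of the allowance by
    the choice of d. The summand 1 makes C positive.\<close>
  define C where "C = 4 * row_bound R * B * (max_area / min_area) + 1"
  have "0 < C" using \<open>0 \<le> B\<close> by (auto simp: C_def less_imp_le intro!: add_nonneg_pos mult_nonneg_nonneg)
  define d where "d = e / (2 * C)"
  have "0 < d" using e \<open>0 < C\<close> by (simp add: d_def)
  obtain k where k: "\<And>i. real (card (boundary_tiles R k (Tile i 1 0))) < d * (l ^ k)\<^sup>2"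
    using eventually_few_boundary_tiles[OF \<open>0 < d\<close>, of R] unfolding eventually_sequentially by blast
  \<comment> \<open>With k fixed, the functions to be averaged are fixed. The factor
    \<open>(l ^ k)\<^sup>2\<close> in the tolerance makes the error at order k + m relative to
    \<open>(l ^ (k + m))\<^sup>2\<close>.\<close>
  have "0 < e / 2 * (l ^ k)\<^sup>2" using e by simp
  from continuous_equidistributed[where h = "super_sum f k", OF continuous_super_sum[OF cont] \<theta> this]
  obtain M where M: "\<And>m j v. M \<le> m \<Longrightarrow> norm v = 1 \<Longrightarrow>
      \<bar>\<Sum>U\<in>super m (Tile j 1 0). super_sum f k (proto U) (v * \<theta> * rotor U)
        - super_sum f k (proto U) (v * rotor U)\<bar> \<le> e / 2 * (l ^ k)\<^sup>2 * (l ^ m)\<^sup>2"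
    unfolding eventually_sequentially by blast
  obtain N where N: "\<And>n i. N \<le> n \<Longrightarrow> real (card (boundary_tiles R n (Tile i 1 0))) < e * (l ^ n)\<^sup>2"
    using eventually_few_boundary_tiles[OF e, of R] unfolding eventually_sequentially by blast
  define m where "m = max M N"
  let ?T = "\<lambda>i. Tile i 1 0 :: 'n tile"
  show thesis
  proof (rule that[of "k + m"])
    show "real (card (boundary_tiles R (k + m) (?T i))) \<le> e * (l ^ (k + m))\<^sup>2" for i
      by (rule less_imp_le, rule N) (simp add: m_def)
    fix i and v :: complex assume v: "norm v = 1"
    have "norm (v * \<theta>) = 1" using v \<theta> by (simp add: norm_mult)
    let ?S = "\<lambda>v. \<Sum>U\<in>super m (?T i). super_sum f k (proto U) (v * rotor U)"
    let ?b = "2 * row_bound R * B * (\<Sum>U\<in>super m (?T i). real (card (boundary_tiles R k U)))"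
    have "(\<Sum>U\<in>super m (?T i). real (card (boundary_tiles R k U))) \<le> (\<Sum>U\<in>super m (?T i). d * (l ^ k)\<^sup>2)"
    proof (rule sum_mono)
      fix U assume "U \<in> super m (?T i)"
      then have "is_tile U" by (rule is_tile_supertile_of[OF is_tile_Tile])
      then show "real (card (boundary_tiles R k U)) \<le> d * (l ^ k)\<^sup>2"
        using k[of "proto U"] card_boundary_tiles by (metis less_imp_le)
    qed
    also have "\<dots> = real (card (super m (?T i))) * (d * (l ^ k)\<^sup>2)" by simp
    also have "\<dots> \<le> max_area / min_area * (l ^ m)\<^sup>2 * (d * (l ^ k)\<^sup>2)"
      using card_supertile_of[OF is_tile_Tile[of i], of m] \<open>0 < d\<close> by (intro mult_right_mono) auto
    finally have "?b \<le> 2 * row_bound R * B * (max_area / min_area * (l ^ m)\<^sup>2 * (d * (l ^ k)\<^sup>2))"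
      using \<open>0 \<le> B\<close> by (intro mult_left_mono) auto
    also have "\<dots> = (C - 1) * (d * (l ^ (k + m))\<^sup>2) / 2"
      by (simp add: C_def power_add power_mult_distrib)
    also have "\<dots> \<le> C * (d * (l ^ (k + m))\<^sup>2) / 2"
      using \<open>0 < d\<close> by (intro divide_right_mono mult_right_mono) auto
    also have "\<dots> = e / 4 * (l ^ (k + m))\<^sup>2"
      using \<open>0 < C\<close> by (simp add: d_def)
    finally have b: "?b \<le> e / 4 * (l ^ (k + m))\<^sup>2" .
    have "\<bar>?S (v * \<theta>) - ?S v\<bar> \<le> e / 2 * (l ^ (k + m))\<^sup>2"
      using M[OF _ v, of m i]
      by (simp add: m_def sum_subtractf power_add power_mult_distrib mult_ac)
    moreover have "\<bar>super_sum f (k + m) i v - ?S v\<bar> \<le> ?b"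
      by (rule super_sum_decompose[OF f \<open>0 < R\<close> v])
    moreover have "\<bar>super_sum f (k + m) i (v * \<theta>) - ?S (v * \<theta>)\<bar> \<le> ?b"
      by (rule super_sum_decompose[OF f \<open>0 < R\<close> \<open>norm (v * \<theta>) = 1\<close>])
    ultimately have "\<bar>super_sum f (k + m) i (v * \<theta>) - super_sum f (k + m) i v\<bar>
        \<le> e / 2 * (l ^ (k + m))\<^sup>2 + 2 * (e / 4 * (l ^ (k + m))\<^sup>2)"
      using b by linarith
    then show "\<bar>super_sum f (k + m) i (v * \<theta>) - super_sum f (k + m) i v\<bar> \<le> e * (l ^ (k + m))\<^sup>2"
      by simp
  qed
qed

subsection \<open>Large balls\<close>

lemma finite_control_points_cball:
  assumes "tiling P \<T>" "0 \<le> r"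
  shows "finite {T \<in> \<T>. cp T \<in> cball 0 r}" "finite (control_points x \<T> \<inter> cball 0 r)"
proof -
  show fin: "finite {T \<in> \<T>. cp T \<in> cball 0 r}"
    using assms unfolding tiling_def
    by (intro cp_packing(1)[of _ r 0]) (auto intro: non_overlapping_subset)
  have "control_points x \<T> \<inter> cball 0 r = cp ` {T \<in> \<T>. cp T \<in> cball 0 r}"
    by (auto simp: control_points_eq)
  with fin show "finite (control_points x \<T> \<inter> cball 0 r)" by simp
qed

text \<open>The tiles near a ball lie in some supertile of high order, so that most of them
  are grouped into supertiles of order n contained in the ball. No decomposition of the
  whole tiling into supertiles is needed.\<close>

lemma pair_sum_ball_diff_le:
  assumes tiling: "substitution_tiling P l \<sigma> \<T>"
    and f: "\<And>z. \<bar>f z\<bar> \<le> B" "\<And>z. f z \<noteq> 0 \<Longrightarrow> norm z < R" and "0 < R"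
    and \<theta>: "norm \<theta> = 1" and "0 \<le> d"
    and sym: "\<And>i v. norm v = 1 \<Longrightarrow> \<bar>super_sum f n i (v * \<theta>) - super_sum f n i v\<bar> \<le> d * (l ^ n)\<^sup>2"
    and few: "\<And>i. real (card (boundary_tiles R n (Tile i 1 0))) \<le> d * (l ^ n)\<^sup>2"
    and r: "0 < r" "l ^ n * diam + diam \<le> r"
  shows "\<bar>pair_sum f (control_points x \<T> \<inter> cball 0 r)
      - pair_sum (\<lambda>z. f (\<theta> * z)) (control_points x \<T> \<inter> cball 0 r)\<bar>
    \<le> (1 + 4 * row_bound R * B) * d * (pi * (r + diam)\<^sup>2 / min_area)
      + 4 * row_bound R * B * (pi * ((r + diam)\<^sup>2 - (r - (l ^ n * diam + diam))\<^sup>2) / min_area)"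
proof -
  have "0 \<le> B" using f(1)[of 0] by linarith
  have til: "tiling P \<T>" using tiling by (simp add: substitution_tiling_def)
  then have no: "non_overlapping P \<T>" and tile\<T>: "\<And>T. T \<in> \<T> \<Longrightarrow> is_tile T"
    and cover: "(\<Union>T\<in>\<T>. tile_set P T) = UNIV"
    by (auto simp: tiling_def)
  define X where "X = {T \<in> \<T>. cp T \<in> cball 0 r}"
  \<comment> \<open>Every tile meeting the ball of radius r + 1 has its control point within r + 1 +
    \<open>diam\<close>. The extra 1 makes the closed ball of radius r interior to the support of
    F.\<close>
  define F where "F = {T \<in> \<T>. cp T \<in> cball 0 (r + 1 + diam)}"
  have finX: "finite X" and finF: "finite F"
    unfolding X_def F_def using finite_control_points_cball(1)[OF til] r by auto
  have L: "control_points x \<T> \<inter> cball 0 r = cp ` X"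
    by (auto simp: X_def control_points_eq)
  have supF: "cball 0 (r + 1) \<subseteq> support P F"
  proof
    fix z :: complex assume z: "z \<in> cball 0 (r + 1)"
    obtain T where T: "T \<in> \<T>" "z \<in> tile_set P T" using cover by blast
    then have "dist (cp T) z \<le> diam" using dist_tile_le tile\<T> cp_in_tile by blast
    then have "cp T \<in> cball 0 (r + 1 + diam)"
      using z norm_triangle_sub[of "cp T" z] by (simp add: dist_norm)
    with T show "z \<in> support P F" by (auto simp: F_def support_def)
  qed
  have "F \<subseteq> \<T>" by (auto simp: F_def)
  then obtain K T0 where T0: "is_tile T0" and FK: "F \<subseteq> super K T0"
    by (rule substitution_tiling_embed[OF tiling finF])
  \<comment> \<open>A supertile of smaller order has diameter at most \<open>l ^ n * diam\<close>,
    too little to contain both r and -r.\<close>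
  have "n \<le> K"
  proof (rule ccontr)
    assume "\<not> n \<le> K"
    have "complex_of_real r \<in> cball 0 (r + 1)" "- complex_of_real r \<in> cball 0 (r + 1)"
      using r by auto
    then have "complex_of_real r \<in> support P (super K T0)" "- complex_of_real r \<in> support P (super K T0)"
      using supF support_mono[OF FK] by blast+
    then obtain p q where pq: "p \<in> tile_set P T0" "q \<in> tile_set P T0"
      "complex_of_real r = l ^ K *\<^sub>R p" "- complex_of_real r = l ^ K *\<^sub>R q"
      by (auto simp: support_supertile_of)
    have "2 * r = norm (complex_of_real r - - complex_of_real r)"
      using r by simp
    also have "complex_of_real r - - complex_of_real r = l ^ K *\<^sub>R (p - q)"
      by (simp only: scaleR_diff_right pq(3,4)[symmetric])
    also have "norm \<dots> = l ^ K * dist p q"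
      using l_gt_1 by (simp add: dist_norm)
    also have "\<dots> \<le> l ^ n * diam"
      using dist_tile_le[OF T0 pq(1,2)] \<open>\<not> n \<le> K\<close> l_gt_1
      by (intro mult_mono power_increasing) auto
    finally show False using r diam_nonneg by linarith
  qed
  then obtain m where K: "K = n + m" using le_Suc_ex by blast
  define I where "I = {U \<in> super m T0. super n U \<subseteq> X}"
  have finI: "finite I" by (simp add: I_def finite_supertile_of)
  have tileI: "is_tile U" if "U \<in> I" for U
    using that is_tile_supertile_of[OF T0] by (auto simp: I_def)
  have noX: "non_overlapping P X" and tileX: "\<And>T. T \<in> X \<Longrightarrow> is_tile T"
    using no tile\<T> non_overlapping_subset[of P \<T> X] by (auto simp: X_def)
  have disI: "U = V" if "U \<in> I" "V \<in> I" "T \<in> super n U" "T \<in> super n V" for U V T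
    using supertile_of_disjoint_nested[OF T0 _ _ that(3,4)] that(1,2) by (auto simp: I_def)
  define Z where "Z = X - (\<Union>U\<in>I. inner_tiles R n U)"
  \<comment> \<open>Near the sphere: an order n supertile has diameter at most
    \<open>l ^ n * diam\<close>, so only tiles in this annulus can belong to one that leaves the
    ball.\<close>
  define A where "A = {T \<in> X. r - l ^ n * diam < norm (cp T)}"
  have dec: "\<bar>pair_sum g (cp ` X) - (\<Sum>U\<in>I. pair_sum g (cp ` super n U))\<bar> \<le> 2 * row_bound R * B * real (card Z)"
    if "\<And>z. \<bar>g z\<bar> \<le> B" "\<And>z. g z \<noteq> 0 \<Longrightarrow> norm z < R" for g
    unfolding Z_def
    by (rule pair_sum_decompose[OF finX noX tileX finI tileI _ disI that \<open>0 < R\<close>]) (auto simp: I_def)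
  have d1: "\<bar>pair_sum f (cp ` X) - (\<Sum>U\<in>I. pair_sum f (cp ` super n U))\<bar> \<le> 2 * row_bound R * B * real (card Z)"
    by (rule dec[OF f])
  have d2: "\<bar>pair_sum (\<lambda>z. f (\<theta> * z)) (cp ` X) - (\<Sum>U\<in>I. pair_sum (\<lambda>z. f (\<theta> * z)) (cp ` super n U))\<bar>
      \<le> 2 * row_bound R * B * real (card Z)"
  proof (rule dec)
    show "norm z < R" if "f (\<theta> * z) \<noteq> 0" for z
      using f(2)[OF that] \<theta> by (simp add: norm_mult)
  qed (rule f)
  have "\<bar>(\<Sum>U\<in>I. pair_sum f (cp ` super n U)) - (\<Sum>U\<in>I. pair_sum (\<lambda>z. f (\<theta> * z)) (cp ` super n U))\<bar>
      \<le> (\<Sum>U\<in>I. \<bar>pair_sum f (cp ` super n U) - pair_sum (\<lambda>z. f (\<theta> * z)) (cp ` super n U)\<bar>)"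
    by (simp only: sum_subtractf[symmetric] sum_abs)
  also have "\<dots> \<le> (\<Sum>U\<in>I. d * (l ^ n)\<^sup>2)"
  proof (rule sum_mono)
    fix U assume "U \<in> I"
    then have U: "is_tile U" by (rule tileI)
    then show "\<bar>pair_sum f (cp ` super n U) - pair_sum (\<lambda>z. f (\<theta> * z)) (cp ` super n U)\<bar> \<le> d * (l ^ n)\<^sup>2"
      using sym[of "rotor U" "proto U"]
      unfolding pair_sum_supertile_of[OF U] super_sum_rotate
      by (simp add: is_tile_def mult.commute abs_minus_commute)
  qed
  finally have d3: "\<bar>(\<Sum>U\<in>I. pair_sum f (cp ` super n U)) - (\<Sum>U\<in>I. pair_sum (\<lambda>z. f (\<theta> * z)) (cp ` super n U))\<bar>
      \<le> real (card I) * (d * (l ^ n)\<^sup>2)" by simp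
  have ZA: "Z \<subseteq> A \<union> (\<Union>U\<in>I. boundary_tiles R n U)"
  proof
    fix T assume T: "T \<in> Z"
    then have TX: "T \<in> X" by (simp add: Z_def)
    then have "T \<in> F" by (auto simp: X_def F_def intro: order_trans add_nonneg_nonneg)
    then obtain U where U: "U \<in> super m T0" "T \<in> super n U"
      using FK by (auto simp: K supertile_of_add)
    then have tU: "is_tile U" using is_tile_supertile_of[OF T0] by blast
    show "T \<in> A \<union> (\<Union>U\<in>I. boundary_tiles R n U)"
    proof (cases "U \<in> I")
      case True
      then show ?thesis using T U by (auto simp: Z_def boundary_tiles_def)
    next
      case False
      then obtain T' where T': "T' \<in> super n U" "T' \<notin> X" using U by (auto simp: I_def)
      have "cp T \<in> support P (super n U)" "cp T' \<in> support P (super n U)"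
        using U T' cp_in_tile by (auto simp: support_def)
      then obtain p q where pq: "p \<in> tile_set P U" "q \<in> tile_set P U"
        "cp T = l ^ n *\<^sub>R p" "cp T' = l ^ n *\<^sub>R q"
        by (auto simp: support_supertile_of)
      have "dist (cp T) (cp T') = l ^ n * dist p q"
        unfolding pq(3,4) dist_norm scaleR_diff_right[symmetric] using l_gt_1 by simp
      also have "\<dots> \<le> l ^ n * diam"
        using dist_tile_le[OF tU pq(1,2)] l_gt_1 by (intro mult_left_mono) auto
      finally have dist: "norm (cp T') \<le> norm (cp T) + l ^ n * diam"
        using norm_triangle_sub[of "cp T'" "cp T"] by (simp add: dist_norm norm_minus_commute)
      have "r - l ^ n * diam < norm (cp T)"
      proof (rule ccontr)
        assume "\<not> ?thesis"
        with dist have le: "norm (cp T') \<le> r" by linarith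
        \<comment> \<open>Away from F the supertile \<open>super K T0\<close> may disagree with the
          tiling. Near the control point of \<open>T'\<close>, however, F already covers everything,
          so \<open>T'\<close> lies in F and therefore in X.\<close>
        have "ball 0 (r + 1) \<subseteq> interior (support P F)"
          using supF by (intro interior_maximal) auto
        then have int: "cp T' \<in> interior (support P F)"
          using le by (auto simp: subset_iff)
        have T'K: "T' \<in> super K T0" using U T' by (auto simp: K supertile_of_add)
        have "T' \<in> F"
          by (rule mem_of_interior_support[OF non_overlapping_supertile_of[OF T0] FK is_tile_supertile_of[OF T0] T'K cp_in_tile int])
        then show False using T' le by (auto simp: F_def X_def)
      qed
      with TX show ?thesis by (simp add: A_def)
    qed
  qed
  have cardI: "real (card I) * (l ^ n)\<^sup>2 \<le> pi * (r + diam)\<^sup>2 / min_area"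
  proof -
    \<comment> \<open>The supertiles are counted after scaling down by \<open>l ^ n\<close>, where
      they become the non-overlapping tiles U of \<open>super m T0\<close>.\<close>
    have "interior (tile_set P U) \<subseteq> cball 0 ((r + diam) / l ^ n)" if "U \<in> I" for U
    proof
      fix z assume "z \<in> interior (tile_set P U)"
      then have "l ^ n *\<^sub>R z \<in> support P (super n U)"
        using interior_subset by (auto simp: support_supertile_of)
      then have "l ^ n *\<^sub>R z \<in> support P X"
        using support_mono[of "super n U" X] that by (auto simp: I_def)
      then obtain T where "T \<in> X" "l ^ n *\<^sub>R z \<in> tile_set P T" by (auto simp: support_def)
      then have "l ^ n *\<^sub>R z \<in> cball 0 (r + diam)"
        using tile_subset_cball[OF tileX, of T 0 r] by (auto simp: X_def)
      then show "z \<in> cball 0 ((r + diam) / l ^ n)"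
        using l_gt_1 by (simp add: pos_le_divide_eq mult.commute)
    qed
    then have "real (card I) \<le> measure lborel (cball (0::complex) ((r + diam) / l ^ n)) / min_area"
      using finI tileI non_overlapping_subset[OF non_overlapping_supertile_of[OF T0, of m], of I]
      by (intro card_packing) (auto simp: I_def intro!: fmeasurable_bounded)
    also have "measure lborel (cball (0::complex) ((r + diam) / l ^ n)) = pi * ((r + diam) / l ^ n)\<^sup>2"
      using r l_gt_1 by (intro measure_lborel_cball_complex divide_nonneg_pos) auto
    finally have "real (card I) * (l ^ n)\<^sup>2 \<le> pi * ((r + diam) / l ^ n)\<^sup>2 / min_area * (l ^ n)\<^sup>2"
      by (intro mult_right_mono) auto
    also have "\<dots> = pi * (r + diam)\<^sup>2 / min_area"
      by (simp add: power_divide)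
    finally show ?thesis .
  qed
  let ?E = "l ^ n * diam + diam"
  have cardA: "real (card A) \<le> pi * ((r + diam)\<^sup>2 - (r - ?E)\<^sup>2) / min_area"
  proof -
    have "interior (tile_set P T) \<subseteq> cball 0 (r + diam) - cball 0 (r - ?E)" if "T \<in> A" for T
    proof
      fix z assume "z \<in> interior (tile_set P T)"
      then have "z \<in> tile_set P T" using interior_subset by blast
      then have "dist (cp T) z \<le> diam"
        using dist_tile_le[OF tileX cp_in_tile] that by (auto simp: A_def)
      moreover have "norm (cp T) \<le> r" "r - l ^ n * diam < norm (cp T)"
        using that by (auto simp: A_def X_def)
      ultimately show "z \<in> cball 0 (r + diam) - cball 0 (r - ?E)"
        using norm_triangle_sub[of z "cp T"] norm_triangle_sub[of "cp T" z]
        by (simp add: dist_norm norm_minus_commute)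
    qed
    then have "real (card A) \<le> measure lborel (cball (0::complex) (r + diam) - cball 0 (r - ?E)) / min_area"
      using finX tileX non_overlapping_subset[OF noX, of A]
      by (intro card_packing) (auto simp: A_def intro!: fmeasurable_bounded bounded_diff)
    also have "measure lborel (cball (0::complex) (r + diam) - cball 0 (r - ?E))
        = measure lborel (cball (0::complex) (r + diam)) - measure lborel (cball (0::complex) (r - ?E))"
    proof (rule measurable_measure_Diff)
      have "0 \<le> l ^ n * diam" using l_gt_1 by simp
      then show "cball (0::complex) (r - ?E) \<subseteq> cball 0 (r + diam)"
        using diam_nonneg by (intro subset_cball) linarith
    qed (auto intro!: fmeasurable_bounded)
    also have "\<dots> = pi * ((r + diam)\<^sup>2 - (r - ?E)\<^sup>2)"
      using r by (simp add: measure_lborel_cball_complex right_diff_distrib)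
    finally show ?thesis .
  qed
  have "card Z \<le> card (A \<union> (\<Union>U\<in>I. boundary_tiles R n U))"
    using ZA finX finI by (intro card_mono) (auto simp: A_def)
  also have "\<dots> \<le> card A + (\<Sum>U\<in>I. card (boundary_tiles R n U))"
    using card_Un_le[of A "\<Union>U\<in>I. boundary_tiles R n U"] card_UN_le[OF finI, of "boundary_tiles R n"] by linarith
  finally have "real (card Z) \<le> real (card A) + (\<Sum>U\<in>I. real (card (boundary_tiles R n U)))"
    by (simp flip: of_nat_sum of_nat_add)
  also have "(\<Sum>U\<in>I. real (card (boundary_tiles R n U))) \<le> (\<Sum>U\<in>I. d * (l ^ n)\<^sup>2)"
  proof (rule sum_mono)
    fix U assume "U \<in> I"
    then show "real (card (boundary_tiles R n U)) \<le> d * (l ^ n)\<^sup>2"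
      using few[of "proto U"] card_boundary_tiles[OF tileI, of U] by simp
  qed
  finally have cardZ: "real (card Z) \<le> real (card A) + real (card I) * (d * (l ^ n)\<^sup>2)" by simp
  have "\<bar>pair_sum f (cp ` X) - pair_sum (\<lambda>z. f (\<theta> * z)) (cp ` X)\<bar>
      \<le> real (card I) * (d * (l ^ n)\<^sup>2) + 2 * (2 * row_bound R * B * real (card Z))"
    using d1 d2 d3 by linarith
  also have "\<dots> \<le> real (card I) * (d * (l ^ n)\<^sup>2)
      + 2 * (2 * row_bound R * B * (real (card A) + real (card I) * (d * (l ^ n)\<^sup>2)))"
    using cardZ \<open>0 \<le> B\<close> by (intro add_left_mono mult_left_mono) auto
  also have "\<dots> = (1 + 4 * row_bound R * B) * d * (real (card I) * (l ^ n)\<^sup>2) + 4 * row_bound R * B * real (card A)"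
    by (simp add: algebra_simps)
  also have "\<dots> \<le> (1 + 4 * row_bound R * B) * d * (pi * (r + diam)\<^sup>2 / min_area)
      + 4 * row_bound R * B * (pi * ((r + diam)\<^sup>2 - (r - ?E)\<^sup>2) / min_area)"
    using \<open>0 \<le> B\<close> \<open>0 \<le> d\<close> cardI cardA by (intro add_mono mult_left_mono) auto
  finally show ?thesis unfolding L .
qed

lemma eventually_pair_sum_ball_symmetric:
  assumes tiling: "substitution_tiling P l \<sigma> \<T>"
    and cont: "continuous_on UNIV f"
    and f: "\<And>z. \<bar>f z\<bar> \<le> B" "\<And>z. f z \<noteq> 0 \<Longrightarrow> norm z < R" and "0 < R"
    and \<theta>: "norm \<theta> = 1" and e: "0 < e"
  shows "\<forall>\<^sub>F r in at_top. \<bar>pair_sum f (control_points x \<T> \<inter> cball 0 r)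
      - pair_sum (\<lambda>z. f (\<theta> * z)) (control_points x \<T> \<inter> cball 0 r)\<bar> \<le> e * (pi * r\<^sup>2)"
proof -
  have "0 \<le> B" using f(1)[of 0] by linarith
  define C where "C = 4 * row_bound R * B"
  have "0 \<le> C" using \<open>0 \<le> B\<close> by (simp add: C_def)
  \<comment> \<open>The first error term becomes e / 8 times the area of a ball of radius r +
    \<open>diam\<close>, which is at most 2 r; this is half of the allowance.\<close>
  define d where "d = e * min_area / 8 / (1 + C)"
  have "0 < d" using e \<open>0 \<le> C\<close> by (simp add: d_def)
  obtain n where n:
    "\<And>i v. norm v = 1 \<Longrightarrow> \<bar>super_sum f n i (v * \<theta>) - super_sum f n i v\<bar> \<le> d * (l ^ n)\<^sup>2"
    "\<And>i. real (card (boundary_tiles R n (Tile i 1 0))) \<le> d * (l ^ n)\<^sup>2"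
    using exists_symmetric_level[OF cont f \<open>0 < R\<close> \<theta> \<open>0 < d\<close>] by blast
  let ?E = "l ^ n * diam + diam"
  have E: "0 \<le> l ^ n * diam" using l_gt_1 by simp
  \<comment> \<open>The annulus term grows only linearly in r; the third condition makes it at most
    the other half of the allowance.\<close>
  have "\<forall>\<^sub>F r in at_top. 0 < r \<and> ?E \<le> r \<and> 6 * C * (diam + ?E) / (min_area * e) \<le> r"
    by (intro eventually_conj eventually_gt_at_top eventually_ge_at_top)
  then show ?thesis
  proof eventually_elim
    case (elim r)
    then have r: "0 < r" "?E \<le> r" "diam \<le> r" using E by auto
    have "\<bar>pair_sum f (control_points x \<T> \<inter> cball 0 r)
        - pair_sum (\<lambda>z. f (\<theta> * z)) (control_points x \<T> \<inter> cball 0 r)\<bar>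
      \<le> (1 + C) * d * (pi * (r + diam)\<^sup>2 / min_area) + C * (pi * ((r + diam)\<^sup>2 - (r - ?E)\<^sup>2) / min_area)"
      unfolding C_def
      by (rule pair_sum_ball_diff_le[OF tiling f \<open>0 < R\<close> \<theta> less_imp_le[OF \<open>0 < d\<close>] n r(1,2)])
    also have "(1 + C) * d * (pi * (r + diam)\<^sup>2 / min_area) = e / 8 * (pi * (r + diam)\<^sup>2)"
    proof -
      have "1 + C \<noteq> 0" using \<open>0 \<le> C\<close> by linarith
      then have "(1 + C) * d = e * min_area / 8"
        using d_def nonzero_eq_divide_eq mult.commute by metis
      then show ?thesis unfolding \<open>(1 + C) * d = e * min_area / 8\<close> by simp
    qed
    also have "\<dots> \<le> e / 8 * (pi * (2 * r)\<^sup>2)"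
      using r e by (intro mult_left_mono power_mono) auto
    also have "\<dots> = e / 2 * (pi * r\<^sup>2)" by (simp add: power2_eq_square)
    also have "C * (pi * ((r + diam)\<^sup>2 - (r - ?E)\<^sup>2) / min_area) \<le> e / 2 * (pi * r\<^sup>2)"
    proof -
      have "(r + diam)\<^sup>2 - (r - ?E)\<^sup>2 = (diam + ?E) * (2 * r + diam - ?E)"
        by (simp add: power2_eq_square algebra_simps)
      also have "\<dots> \<le> (diam + ?E) * (3 * r)"
        using r E diam_nonneg by (intro mult_left_mono) auto
      finally have "C * (pi * ((r + diam)\<^sup>2 - (r - ?E)\<^sup>2) / min_area) \<le> C * (pi * ((diam + ?E) * (3 * r)) / min_area)"
        using \<open>0 \<le> C\<close> min_area_pos by (intro mult_left_mono divide_right_mono) (auto simp: less_imp_le)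
      also have "\<dots> = (6 * C * (diam + ?E) / (min_area * e)) * (e / 2 * (pi * r))"
        using e by (simp add: field_simps)
      also have "\<dots> \<le> r * (e / 2 * (pi * r))"
        using elim e by (intro mult_right_mono) auto
      finally show ?thesis by (simp only: power2_eq_square mult_ac)
    qed
    finally show ?case by (simp add: mult.left_commute)
  qed
qed

end

subsection \<open>Autocorrelations\<close>

lemma scale_measure_eq_density: "scale_measure c M = density M (\<lambda>_. c)"
  by (rule measure_eqI) (simp_all add: emeasure_density nn_integral_cmult_indicator)

lemma integral_autocorrelation_approx:
  fixes f :: "complex \<Rightarrow> real"
  assumes "finite (\<Lambda> \<inter> cball 0 r)" "continuous_on UNIV f" "0 \<le> r"
  shows "integral\<^sup>L (autocorrelation_approx \<Lambda> r) f = pair_sum f (\<Lambda> \<inter> cball 0 r) / (pi * r\<^sup>2)"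
proof -
  let ?L = "\<Lambda> \<inter> cball 0 r"
  have [measurable]: "f \<in> borel_measurable borel"
    using assms(2) by (rule borel_measurable_continuous_onI)
  have "integral\<^sup>L (autocorrelation_approx \<Lambda> r) f
      = (1 / (pi * r\<^sup>2)) * integral\<^sup>L (distr (count_space (?L \<times> ?L)) borel (\<lambda>(x, y). x - y)) f"
    unfolding autocorrelation_approx_def scale_measure_eq_density
    using assms(3) by (subst integral_density) (auto simp: measure_lborel_cball_complex)
  also have "integral\<^sup>L (distr (count_space (?L \<times> ?L)) borel (\<lambda>(x, y). x - y)) f
      = (\<Sum>(x, y)\<in>?L \<times> ?L. f (x - y))"
    using assms(1) by (subst integral_distr) (auto simp: lebesgue_integral_count_space_finite case_prod_beta)
  also have "\<dots> = pair_sum f ?L"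
    by (simp add: pair_sum_def sum.cartesian_product)
  finally show ?thesis by simp
qed

lemma radon_measure_rotate:
  assumes "radon_measure \<mu>"
  shows "radon_measure (rotate_measure \<theta> \<mu>)"
  unfolding radon_measure_def
proof (intro conjI allI impI)
  show "sets (rotate_measure \<theta> \<mu>) = sets borel" by (simp add: rotate_measure_def)
  fix K :: "complex set" assume K: "compact K"
  have sets: "sets \<mu> = sets borel" using assms by (simp add: radon_measure_def)
  have m: "(\<lambda>z. cis \<theta> * z) \<in> measurable \<mu> borel"
    by (subst measurable_cong_sets[OF sets refl])
       (intro borel_measurable_continuous_onI continuous_intros)
  have "(\<lambda>z. cis \<theta> * z) -` K = (\<lambda>z. cis (- \<theta>) * z) ` K"
  proof (intro subset_antisym subsetI)
    fix z assume "z \<in> (\<lambda>z. cis \<theta> * z) -` K"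
    then show "z \<in> (\<lambda>z. cis (- \<theta>) * z) ` K"
      by (intro image_eqI[where x = "cis \<theta> * z"]) (simp_all add: cis_mult flip: mult.assoc)
  qed (auto simp: cis_mult simp flip: mult.assoc)
  then have "compact ((\<lambda>z. cis \<theta> * z) -` K)"
    using K by (auto intro!: compact_continuous_image continuous_intros)
  moreover have "space \<mu> = UNIV" using sets_eq_imp_space_eq[OF sets] by simp
  moreover have "emeasure (rotate_measure \<theta> \<mu>) K = emeasure \<mu> ((\<lambda>z. cis \<theta> * z) -` K \<inter> space \<mu>)"
    unfolding rotate_measure_def by (rule emeasure_distr[OF m borel_compact[OF K]])
  ultimately show "emeasure (rotate_measure \<theta> \<mu>) K < \<infinity>"
    using assms by (simp add: radon_measure_def)
qed

theorem theorem3p1: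
  fixes P :: "'n::finite \<Rightarrow> complex set" and l :: real and \<sigma> :: "'n \<Rightarrow> 'n tile set"
    and \<T> :: "'n tile set" and x :: "'n \<Rightarrow> complex" and \<gamma> :: "complex measure"
  assumes "prototiles P"
    and "primitive_substitution_tiling P l \<sigma> \<T>"
    and "statistical_circular_symmetry l \<sigma> \<T>"
    and "\<And>i. x i \<in> P i"
    and "autocorrelation (control_points x \<T>) \<gamma>"
  shows "circular_symmetric \<gamma>"
proof -
  have tiling: "substitution_tiling P l \<sigma> \<T>" and prim: "primitive_substitution \<sigma>"
    using assms(2) by (auto simp: primitive_substitution_tiling_def)
  interpret substitution_system P l \<sigma> x
    by unfold_locales (use assms tiling in \<open>auto simp: substitution_tiling_def\<close>)
  interpret equidistributed_substitution P l \<sigma> x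
  proof
    fix q :: nat and i :: 'n and e :: real assume "0 < q" "0 < e"
    from exists_cancellation[OF tiling assms(3) \<open>0 < q\<close>] eventually_weyl_small[OF prim _ _ _ _ _ \<open>0 < e\<close>]
    show "\<forall>\<^sub>F k in sequentially. \<forall>j. norm (weyl q k i (Tile j 1 0)) < e * (l ^ k)\<^sup>2"
      by blast
  qed
  have til: "tiling P \<T>" using tiling by (simp add: substitution_tiling_def)
  let ?\<Lambda> = "control_points x \<T>"
  have radon: "radon_measure \<gamma>" and sets: "sets \<gamma> = sets borel"
    using assms(5) by (auto simp: autocorrelation_def radon_measure_def)
  obtain r where r: "filterlim r at_top sequentially"
    and vague: "vague_conv (\<lambda>n. autocorrelation_approx ?\<Lambda> (r n)) \<gamma> sequentially"
    using assms(5) by (auto simp: autocorrelation_def)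
  show ?thesis
    unfolding circular_symmetric_def
  proof (intro allI radon_measure_eqI radon_measure_rotate radon)
    fix \<theta> :: real and f :: "complex \<Rightarrow> real"
    assume cont: "continuous_on UNIV f" and supp: "compact (closure {z. f z \<noteq> 0})"
    let ?g = "\<lambda>z. f (cis \<theta> * z)"
    have contg: "continuous_on UNIV ?g"
      by (intro continuous_on_compose2[OF cont] continuous_intros) auto
    have "bounded {z. f z \<noteq> 0}" using supp by simp
    then obtain R where "0 < R" and R: "\<And>z. f z \<noteq> 0 \<Longrightarrow> norm z < R"
      unfolding bounded_pos_less by auto
    have suppg: "compact (closure {z. ?g z \<noteq> 0})"
      unfolding compact_closure bounded_iff
      using R by (intro exI[of _ R]) (force simp: norm_mult)
    have "bounded (f ` closure {z. f z \<noteq> 0})"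
      using supp cont by (intro compact_imp_bounded compact_continuous_image) (auto intro: continuous_on_subset)
    then obtain B where B: "0 < B" "\<And>z. z \<in> closure {z. f z \<noteq> 0} \<Longrightarrow> \<bar>f z\<bar> \<le> B"
      unfolding bounded_pos by auto
    have fB: "\<bar>f z\<bar> \<le> B" for z
      using B closure_subset[of "{z. f z \<noteq> 0}"] by (cases "f z = 0") auto
    let ?I = "\<lambda>n h. integral\<^sup>L (autocorrelation_approx ?\<Lambda> (r n)) h"
    have lim: "(\<lambda>n. ?I n f - ?I n ?g) \<longlonglongrightarrow> integral\<^sup>L \<gamma> f - integral\<^sup>L \<gamma> ?g"
      using vague cont contg supp suppg unfolding vague_conv_def by (intro tendsto_diff) auto
    have "(\<lambda>n. ?I n f - ?I n ?g) \<longlonglongrightarrow> 0"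
    proof (rule tendstoI)
      fix e :: real assume "0 < e"
      then have "0 < e / 2" by simp
      \<comment> \<open>The estimate holds for all large radii, hence along the particular sequence
        r that defines \<gamma>.\<close>
      have "\<forall>\<^sub>F s in at_top. \<bar>pair_sum f (?\<Lambda> \<inter> cball 0 s) - pair_sum ?g (?\<Lambda> \<inter> cball 0 s)\<bar> \<le> e / 2 * (pi * s\<^sup>2)"
        by (rule eventually_pair_sum_ball_symmetric[OF tiling cont fB R \<open>0 < R\<close> _ \<open>0 < e / 2\<close>]) simp_all
      then have "\<forall>\<^sub>F s in at_top. \<bar>integral\<^sup>L (autocorrelation_approx ?\<Lambda> s) f
          - integral\<^sup>L (autocorrelation_approx ?\<Lambda> s) ?g\<bar> \<le> e / 2"
        using eventually_gt_at_top[of 0]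
      proof eventually_elim
        case (elim s)
        then have fin: "finite (?\<Lambda> \<inter> cball 0 s)"
          using finite_control_points_cball[OF til] by simp
        show ?case
          using elim
          by (simp add: integral_autocorrelation_approx[OF fin] cont contg abs_divide
              pos_divide_le_eq flip: diff_divide_distrib)
      qed
      then have "\<forall>\<^sub>F n in sequentially. \<bar>?I n f - ?I n ?g\<bar> \<le> e / 2"
        by (rule eventually_compose_filterlim[OF _ r])
      then show "\<forall>\<^sub>F n in sequentially. dist (?I n f - ?I n ?g) 0 < e"
        by eventually_elim (use \<open>0 < e\<close> in simp)
    qed
    with lim have "integral\<^sup>L \<gamma> f = integral\<^sup>L \<gamma> ?g"
      using LIMSEQ_unique by fastforce
    also have "\<dots> = integral\<^sup>L (rotate_measure \<theta> \<gamma>) f"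
      unfolding rotate_measure_def
    proof (rule integral_distr[symmetric])
      show "(\<lambda>z. cis \<theta> * z) \<in> measurable \<gamma> borel"
        by (subst measurable_cong_sets[OF sets refl])
           (intro borel_measurable_continuous_onI continuous_intros)
      show "f \<in> borel_measurable borel"
        using cont by (rule borel_measurable_continuous_onI)
    qed
    finally show "integral\<^sup>L (rotate_measure \<theta> \<gamma>) f = integral\<^sup>L \<gamma> f" by simp
  qed
qed

end
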